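(* For $p\ge1$, the randomized communication complexity (in the $k$-party blackboard model) of approximating $\|x\|_p$, where $x=\sum_{i=1}^k x^i$ and party $i$ holds the vector $x^i$, up to a factor of $1+\varepsilon$ with constant (sufficiently high) success probability, is $\Omega(k/\varepsilon^2)$.
   Context: Blackboard model: $k$ parties each hold a private input vector (with entries encoded by $O(\log N)$ bits, $N$ the dimension); every message is seen by all parties; cost is the total number of bits communicated. $\|x\|_p=(\sum_j|x_j|^p)^{1/p}$.
   Formalization: The bound is stated for k ≥ 2 parties, 0 < ε < 1 and dimension N ≥ C/ε² (signed integer entries of size at most N^d); for k = 1 or for N much smaller than 1/ε² the claim fails, since the parties can write the answer or their inputs. *)

theory Defs
  imports "HOL-Probability.Probability"
begin

text \<open>
  A deterministic blackboard protocol is a binary tree. At an inner node the blackboard contents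
  (the path from the root) determine which party speaks next; that party writes one bit, a function
  of its own private input and of the blackboard contents. At a leaf the blackboard contents
  determine the output.
\<close>

datatype 'x protocol =
    Output real
  | Speak nat "'x \<Rightarrow> bool" "'x protocol" "'x protocol"

primrec run :: "'x protocol \<Rightarrow> (nat \<Rightarrow> 'x) \<Rightarrow> real" where
  "run (Output v) X = v"
| "run (Speak i f P Q) X = (if f (X i) then run P X else run Q X)"

primrec bits :: "'x protocol \<Rightarrow> (nat \<Rightarrow> 'x) \<Rightarrow> nat" where
  "bits (Output v) X = 0"
| "bits (Speak i f P Q) X = Suc (if f (X i) then bits P X else bits Q X)"

primrec speakers :: "'x protocol \<Rightarrow> nat set" where
  "speakers (Output v) = {}"
| "speakers (Speak i f P Q) = insert i (speakers P \<union> speakers Q)"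

text \<open>
  A randomized protocol is a probability distribution on deterministic protocols (public coins;
  private coins are subsumed, as all coins may be drawn in advance). \<open>I\<close> is the set of
  joint inputs and \<open>R X v\<close> says that \<open>v\<close> is an acceptable output on input \<open>X\<close>.
\<close>

definition solves ::
    "nat \<Rightarrow> (nat \<Rightarrow> 'x) set \<Rightarrow> ((nat \<Rightarrow> 'x) \<Rightarrow> real \<Rightarrow> bool) \<Rightarrow> real \<Rightarrow> 'x protocol pmf \<Rightarrow> bool" where
  "solves k I R q D \<longleftrightarrow>
     (\<forall>P\<in>set_pmf D. speakers P \<subseteq> {..<k}) \<and>
     (\<forall>X\<in>I. measure_pmf.prob D {P. R X (run P X)} \<ge> q)"

definition protocol_cost :: "(nat \<Rightarrow> 'x) set \<Rightarrow> 'x protocol pmf \<Rightarrow> enat" where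
  "protocol_cost I D = (SUP P\<in>set_pmf D. SUP X\<in>I. enat (bits P X))"

definition randomized_complexity ::
    "nat \<Rightarrow> (nat \<Rightarrow> 'x) set \<Rightarrow> ((nat \<Rightarrow> 'x) \<Rightarrow> real \<Rightarrow> bool) \<Rightarrow> real \<Rightarrow> enat" where
  "randomized_complexity k I R q = (INF D\<in>{D. solves k I R q D}. protocol_cost I D)"

definition lp_norm :: "real \<Rightarrow> nat \<Rightarrow> (nat \<Rightarrow> int) \<Rightarrow> real" where
  "lp_norm p N x = (\<Sum>j<N. \<bar>real_of_int (x j)\<bar> powr p) powr (1 / p)"

text \<open>
  Entries encoded by \<open>O(log N)\<close> bits: integers of absolute value at most \<open>N\<close> to the power \<open>d\<close>,
  for a constant \<open>d\<close>. In \<open>X \<in> party_inputs d k N\<close>, \<open>X i\<close> is the vector of party \<open>i\<close>.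
\<close>

definition party_inputs :: "real \<Rightarrow> nat \<Rightarrow> nat \<Rightarrow> (nat \<Rightarrow> nat \<Rightarrow> int) set" where
  "party_inputs d k N =
     ({..<k} \<rightarrow>\<^sub>E ({..<N} \<rightarrow>\<^sub>E {a :: int. \<bar>real_of_int a\<bar> \<le> real N powr d}))"

definition approximates_lp_norm ::
    "real \<Rightarrow> nat \<Rightarrow> nat \<Rightarrow> real \<Rightarrow> (nat \<Rightarrow> nat \<Rightarrow> int) \<Rightarrow> real \<Rightarrow> bool" where
  "approximates_lp_norm p k N \<epsilon> X v \<longleftrightarrow>
     (let r = lp_norm p N (\<lambda>j. \<Sum>i<k. X i j)
      in r / (1 + \<epsilon>) \<le> v \<and> v \<le> (1 + \<epsilon>) * r)"

definition lp_norm_complexity :: "real \<Rightarrow> real \<Rightarrow> nat \<Rightarrow> nat \<Rightarrow> real \<Rightarrow> real \<Rightarrow> enat" where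
  "lp_norm_complexity p d k N \<epsilon> q =
     randomized_complexity k (party_inputs d k N) (approximates_lp_norm p k N \<epsilon>) q"

end

theory Submission
  imports Defs
begin

text \<open>
  For two parties the problem is Gap Hamming: estimate the number of agreements of two vectors in
  \<open>{-1, 1}\<^sup>m\<close> up to order \<open>\<surd>m\<close>. The operator on \<open>{-1, 1}\<^sup>m\<close> with kernel \<open>exp (i agree(x, y) / \<surd>m)\<close>
  is hypercontractive from \<open>L\<^sub>1\<^sub>+\<^sub>1\<^sub>/\<^sub>m\<close> to \<open>L\<^sub>m\<^sub>+\<^sub>1\<close>, with a norm that beats the trivial one: the
  two-point case is elementary and it tensorizes by Minkowski's inequality. Applied to indicator
  functions this says that the kernel sums to at most \<open>63/16 \<cdot> area\<close> to the power \<open>m / (m + 1)\<close>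
  over a rectangle, whereas it is nearly constant where the agreement stays in a window of width
  \<open>c\<surd>m\<close>. A protocol of \<open>t\<close> bits cuts the cube into \<open>2\<^sup>t\<close> rectangles of constant output, and by
  concavity these bounds add up to a constant fraction below \<open>4\<^sup>m\<close> unless \<open>t = \<Omega>(m)\<close>.

  For \<open>k = 2h\<close> parties, draw the \<open>n\<close> columns of a \<open>k \<times> n\<close> sign matrix independently and
  uniformly among those with sum in \<open>{-2, 0, 2}\<close>; the sum then takes only the absolute values 0
  and 2, which makes the exponent \<open>p\<close> irrelevant. Fix a pair of parties and reveal everybody
  else's input. A column in which the others sum to 0 leaves the two entries of the pair uniform
  and independent, and this happens for a constant fraction of the columns. So every pair faces
  a two-party Gap Hamming problem of dimension \<open>\<Omega>(n)\<close>, speaks \<open>\<Omega>(n)\<close> bits, and summing over the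
  \<open>h\<close> disjoint pairs gives \<open>\<Omega>(kn)\<close> with \<open>n\<close> of order \<open>1 / \<epsilon>\<^sup>2\<close>.
\<close>

section \<open>A two-point inequality\<close>

lemma cos_ge_quadratic: "1 - x\<^sup>2 / 2 \<le> cos x" for x :: real
proof -
  have "(sin (x / 2))\<^sup>2 \<le> (x / 2)\<^sup>2"
    by (metis abs_sin_x_le_abs_x abs_le_square_iff)
  moreover have "cos x = 1 - 2 * (sin (x / 2))\<^sup>2"
    using cos_double_sin[of "x / 2"] by simp
  ultimately show ?thesis by (simp add: power_divide)
qed

lemma cos_le_quadratic:
  fixes x :: real
  assumes "\<bar>x\<bar> \<le> 1"
  shows "cos x \<le> 1 - x\<^sup>2 / 4"
proof -
  obtain t where "cos x = (\<Sum>m<4. cos_coeff m * x ^ m) + cos (t + 1 / 2 * real 4 * pi) / fact 4 * x ^ 4"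
    using Maclaurin_cos_expansion[of x 4] by blast
  moreover have "(\<Sum>m<4. cos_coeff m * x ^ m) = 1 - x\<^sup>2 / 2"
    by (simp add: eval_nat_numeral cos_coeff_Suc sin_coeff_Suc)
  moreover have "cos (t + 1 / 2 * real 4 * pi) * x ^ 4 \<le> 1 * x\<^sup>2"
  proof (rule mult_mono)
    show "x ^ 4 \<le> x\<^sup>2"
      using power_decreasing[of 2 4 "\<bar>x\<bar>"] assms by simp
  qed simp_all
  ultimately have "cos x \<le> 1 - x\<^sup>2 / 2 + x\<^sup>2 / 24" by (simp add: fact_numeral)
  then show ?thesis using zero_le_power2[of x] by linarith
qed

lemma powr_one_plus_ge:
  fixes t e :: real
  assumes "0 \<le> t"
  shows "t + e * (t * ln t) \<le> t powr (1 + e)"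
proof (cases "t = 0")
  case False
  have "t * (1 + e * ln t) \<le> t * exp (e * ln t)"
    using assms by (intro mult_left_mono exp_ge_add_one_self)
  then show ?thesis using False assms by (simp add: powr_def exp_add algebra_simps)
qed simp

lemma mult_ln_one_plus_ge:
  fixes v :: real
  assumes "0 \<le> v" "v \<le> 1"
  shows "v + v\<^sup>2 / 3 \<le> (1 + v) * ln (1 + v)"
proof (cases "v = 0")
  case False
  then have "2 * v / (2 + v) \<le> ln (1 + v)"
    using ln_approx_bounds[of "1 + v" 1] assms by (simp add: add_ac)
  then have "(1 + v) * (2 * v / (2 + v)) \<le> (1 + v) * ln (1 + v)"
    using assms by (intro mult_left_mono) auto
  moreover have "v + v\<^sup>2 / 3 \<le> v + v\<^sup>2 / (2 + v)"
    using assms by (intro add_left_mono divide_left_mono) auto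
  moreover have "v + v\<^sup>2 / (2 + v) = (1 + v) * (2 * v / (2 + v))"
    using assms by (simp add: field_simps power2_eq_square)
  ultimately show ?thesis by linarith
qed simp

lemma mult_ln_ge:
  fixes t :: real
  assumes "0 \<le> t"
  shows "t - 1 \<le> t * ln t"
proof (cases "t = 0")
  case False
  then have "t > 0" using assms by simp
  then have "t * - ln t \<le> t * (1 / t - 1)"
    using ln_le_minus_one[of "1 / t"] by (intro mult_left_mono) (auto simp: ln_div)
  then show ?thesis using \<open>t > 0\<close> by (simp add: algebra_simps)
qed simp

lemma sum_powr_one_plus_ge:
  fixes v e :: real
  assumes "\<bar>v\<bar> \<le> 1" "0 \<le> e"
  shows "2 + e * v\<^sup>2 / 3 \<le> (1 + v) powr (1 + e) + (1 - v) powr (1 + e)"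
proof -
  have nonneg: "2 + e * v\<^sup>2 / 3 \<le> (1 + v) powr (1 + e) + (1 - v) powr (1 + e)"
    if "0 \<le> v" "v \<le> 1" for v :: real
  proof -
    have "v\<^sup>2 / 3 \<le> (1 + v) * ln (1 + v) + (1 - v) * ln (1 - v)"
      using mult_ln_one_plus_ge[of v] mult_ln_ge[of "1 - v"] that by simp
    then have "e * (v\<^sup>2 / 3) \<le> e * ((1 + v) * ln (1 + v) + (1 - v) * ln (1 - v))"
      using assms(2) by (rule mult_left_mono)
    then show ?thesis
      using powr_one_plus_ge[of "1 + v" e] powr_one_plus_ge[of "1 - v" e] that
      by (simp add: algebra_simps)
  qed
  show ?thesis
    using nonneg[of v] nonneg[of "- v"] assms by (cases "0 \<le> v") (auto simp: algebra_simps)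
qed

lemma powr_one_plus_inverse_power:
  fixes x :: real
  assumes "0 \<le> x" "m \<ge> 1"
  shows "(x powr (1 + 1 / real m)) ^ m = x ^ (m + 1)"
proof (cases "x = 0")
  case False
  then have "(x powr (1 + 1 / m)) ^ m = x powr ((1 + 1 / m) * m)"
    using assms by (simp add: powr_realpow[symmetric] powr_powr)
  also have "(1 + 1 / m) * real m = real (m + 1)"
    using assms by (simp add: field_simps)
  finally show ?thesis
    using False assms by (simp add: powr_realpow del: of_nat_Suc of_nat_add)
qed (use assms in simp)

lemma power_sum_powr_ge:
  fixes s v :: real
  assumes "0 \<le> s" "\<bar>v\<bar> \<le> 1" "m \<ge> 1"
  shows "s ^ (m + 1) * (1 + v\<^sup>2 / 6) / 2
    \<le> ((s * (1 + v) / 2) powr (1 + 1 / real m) + (s * (1 - v) / 2) powr (1 + 1 / real m)) ^ m"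
proof -
  define e where "e = 1 + 1 / real m"
  have "1 + v\<^sup>2 / 6 = 1 + real m * (1 / m * v\<^sup>2 / 6)" using assms(3) by simp
  also have "\<dots> \<le> (1 + 1 / m * v\<^sup>2 / 6) ^ m"
    by (rule Bernoulli_inequality, rule order.trans[of _ 0]) auto
  also have "\<dots> \<le> (((1 + v) powr e + (1 - v) powr e) / 2) ^ m"
    using sum_powr_one_plus_ge[OF assms(2), of "1 / m"] by (intro power_mono) (auto simp: e_def)
  finally have "s ^ (m + 1) * (1 + v\<^sup>2 / 6) / 2
      \<le> s ^ (m + 1) * (((1 + v) powr e + (1 - v) powr e) / 2) ^ m / 2"
    using assms(1) by (intro divide_right_mono mult_left_mono) auto
  also have "\<dots> = ((s / 2) powr e * ((1 + v) powr e + (1 - v) powr e)) ^ m"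
    using assms(1,3) powr_one_plus_inverse_power[of "s / 2" m]
    by (simp add: e_def power_mult_distrib power_divide)
  also have "(s / 2) powr e * ((1 + v) powr e + (1 - v) powr e)
      = (s * (1 + v) / 2) powr e + (s * (1 - v) / 2) powr e"
    using assms(1,2) powr_mult[of "s / 2" "1 + v" e] powr_mult[of "s / 2" "1 - v" e]
    by (simp add: ring_distribs add_divide_distrib diff_divide_distrib abs_le_iff)
  finally show ?thesis by (simp add: e_def)
qed

lemma norm_rotate_sum_squares:
  "(cmod (cis \<theta> * u + w))\<^sup>2 + (cmod (u + cis \<theta> * w))\<^sup>2
     = 2 * ((cmod u)\<^sup>2 + (cmod w)\<^sup>2) + 4 * (cos \<theta> * Re (u * cnj w))"
proof -
  have expand: "(cmod (a + b))\<^sup>2 = (cmod a)\<^sup>2 + (cmod b)\<^sup>2 + 2 * Re (a * cnj b)" for a b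
    unfolding cmod_power2 by (simp add: algebra_simps power2_eq_square)
  show ?thesis
    unfolding expand by (simp add: norm_mult algebra_simps)
qed

lemma power_one_minus_le:
  fixes z q :: real
  assumes "0 \<le> z" "z \<le> 1" "0 \<le> q" "q \<le> 1" "q \<le> real n * z"
  shows "(1 - z) ^ n \<le> 1 - q / 2"
proof -
  have "(1 - z) ^ n * (1 + q) \<le> (1 - z) ^ n * (1 + z) ^ n"
    using assms Bernoulli_inequality[of z n] by (intro mult_left_mono) auto
  also have "\<dots> = (1 - z\<^sup>2) ^ n"
    unfolding power_mult_distrib[symmetric] by (simp add: power2_eq_square algebra_simps)
  also have "\<dots> \<le> 1"
    using assms by (intro power_le_one) (auto simp: power_le_one)
  also have "1 \<le> (1 - q / 2) * (1 + q)"
    using assms mult_left_mono[of q 1 q] by (simp add: algebra_simps)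
  finally show ?thesis using assms(3) by (simp add: mult_le_cancel_right)
qed

lemma sum_powers_le_of_sum_squares:
  fixes a b s y :: real
  assumes "0 \<le> a" "a \<le> s" "0 \<le> b" "b \<le> s" "y \<le> 1"
    and "a\<^sup>2 + b\<^sup>2 \<le> 2 * (s\<^sup>2 * (1 - y))"
  shows "a ^ n + b ^ n \<le> s ^ n * (1 + (1 - y / 2) ^ n)"
proof -
  have "2 * (min a b)\<^sup>2 \<le> a\<^sup>2 + b\<^sup>2"
    using assms power_mono[of "min a b" a 2] power_mono[of "min a b" b 2] by linarith
  also note assms(6)
  also have "s\<^sup>2 * (1 - y) \<le> (s * (1 - y / 2))\<^sup>2"
    unfolding power_mult_distrib
    by (intro mult_left_mono) (auto simp: power2_eq_square algebra_simps)
  finally have "(min a b)\<^sup>2 \<le> (s * (1 - y / 2))\<^sup>2" by simp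
  then have "min a b \<le> s * (1 - y / 2)"
    by (rule power2_le_imp_le) (use assms in simp)
  then have "min a b ^ n \<le> (s * (1 - y / 2)) ^ n"
    using assms by (intro power_mono) auto
  moreover have "max a b ^ n \<le> s ^ n"
    using assms by (intro power_mono) auto
  moreover have "a ^ n + b ^ n = min a b ^ n + max a b ^ n"
    by (simp add: min_def max_def)
  ultimately show ?thesis by (simp add: power_mult_distrib distrib_left)
qed

lemma norm_rotate_sum_squares_le:
  fixes m :: nat
  defines "\<theta> \<equiv> 1 / sqrt (real m)"
  assumes m: "m \<ge> 1"
  shows "(cmod (cis \<theta> * u + w))\<^sup>2 + (cmod (u + cis \<theta> * w))\<^sup>2
    \<le> 2 * ((cmod u)\<^sup>2 + (cmod w)\<^sup>2) + 4 * ((1 - 1 / (4 * m)) * (cmod u * cmod w))"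
proof -
  have \<theta>: "0 \<le> \<theta>" "\<theta> \<le> 1" "\<theta>\<^sup>2 = 1 / m" using m by (auto simp: \<theta>_def power_divide)
  have "0 \<le> cos \<theta>" using \<theta> pi_gt3 by (intro cos_ge_zero) auto
  moreover have "Re (u * cnj w) \<le> cmod u * cmod w"
    by (metis complex_Re_le_cmod complex_mod_cnj norm_mult)
  moreover have "cos \<theta> \<le> 1 - 1 / (4 * m)" using cos_le_quadratic[of \<theta>] \<theta> by simp
  ultimately have "cos \<theta> * Re (u * cnj w) \<le> (1 - 1 / (4 * m)) * (cmod u * cmod w)"
    by (meson mult_left_mono mult_right_mono norm_ge_zero mult_nonneg_nonneg order.trans)
  then show ?thesis by (simp add: norm_rotate_sum_squares)
qed

lemma sum_norm_rotate_powers_le: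
  fixes u w :: complex and m :: nat
  defines "\<theta> \<equiv> 1 / sqrt (real m)"
  assumes m: "m \<ge> 1" and "0 \<le> s" and v: "\<bar>v\<bar> \<le> 1"
    and u: "cmod u = s * (1 + v) / 2" and w: "cmod w = s * (1 - v) / 2"
  shows "cmod (cis \<theta> * u + w) ^ (m + 1) + cmod (u + cis \<theta> * w) ^ (m + 1)
    \<le> s ^ (m + 1) * (2 - (1 - v\<^sup>2) / 32)"
proof -
  define y where "y = (1 - v\<^sup>2) / (8 * m)"
  have v2: "0 \<le> 1 - v\<^sup>2" using v by (simp add: abs_square_le_1)
  have "1 - v\<^sup>2 \<le> 8 * real m" using m zero_le_power2[of v] by linarith
  then have y: "0 \<le> y" "y \<le> 1"
    unfolding y_def using v2 m by (intro divide_nonneg_nonneg divide_le_eq_1_pos[THEN iffD2]; simp)+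
  have "s = cmod u + cmod w" using u w by (simp add: field_simps)
  then have "cmod (cis \<theta> * u + w) \<le> s" "cmod (u + cis \<theta> * w) \<le> s"
    using norm_triangle_ineq[of "cis \<theta> * u" w] norm_triangle_ineq[of u "cis \<theta> * w"]
    by (auto simp: norm_mult)
  moreover have "(cmod (cis \<theta> * u + w))\<^sup>2 + (cmod (u + cis \<theta> * w))\<^sup>2 \<le> 2 * (s\<^sup>2 * (1 - y))"
  proof -
    have "(cmod (cis \<theta> * u + w))\<^sup>2 + (cmod (u + cis \<theta> * w))\<^sup>2
        \<le> 2 * ((cmod u)\<^sup>2 + (cmod w)\<^sup>2) + 4 * ((1 - 1 / (4 * m)) * (cmod u * cmod w))"
      unfolding \<theta>_def by (rule norm_rotate_sum_squares_le[OF m])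
    also have "\<dots> = 2 * (s\<^sup>2 * (1 - y))"
      using m unfolding u w y_def by (simp add: field_simps power2_eq_square)
    finally show ?thesis .
  qed
  ultimately have "cmod (cis \<theta> * u + w) ^ (m + 1) + cmod (u + cis \<theta> * w) ^ (m + 1)
      \<le> s ^ (m + 1) * (1 + (1 - y / 2) ^ (m + 1))"
    using y by (intro sum_powers_le_of_sum_squares) auto
  also have "\<dots> \<le> s ^ (m + 1) * (1 + (1 - (1 - v\<^sup>2) / 16 / 2))"
  proof (intro mult_left_mono add_left_mono power_one_minus_le)
    have "(1 - v\<^sup>2) / 16 = real m * (y / 2)" using m by (simp add: y_def)
    then show "(1 - v\<^sup>2) / 16 \<le> real (m + 1) * (y / 2)" using y by (simp add: algebra_simps)
    have "1 - v\<^sup>2 \<le> 16" using zero_le_power2[of v] by linarith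
    then show "(1 - v\<^sup>2) / 16 \<le> 1" by (subst divide_le_eq_1_pos) simp_all
  qed (use v2 y \<open>0 \<le> s\<close> in auto)
  finally show ?thesis by simp
qed

text \<open>
  The two rotations cannot both align \<open>u\<close> with \<open>w\<close>; this gains on the left when \<open>\<bar>u\<bar> \<approx> \<bar>w\<bar>\<close>.
  Otherwise the gain comes from the strict convexity of the power function on the right.
\<close>

lemma two_point_inequality:
  fixes u w :: complex and m :: nat
  defines "\<theta> \<equiv> 1 / sqrt (real m)"
  assumes m: "m \<ge> 1"
  shows "cmod (cis \<theta> * u + w) ^ (m + 1) + cmod (u + cis \<theta> * w) ^ (m + 1)
    \<le> 63 / 16 * (cmod u powr (1 + 1 / real m) + cmod w powr (1 + 1 / real m)) ^ m"
proof -
  define s where "s = cmod u + cmod w"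
  define v where "v = (cmod u - cmod w) / s"
  have s: "0 \<le> s" by (simp add: s_def)
  have "\<bar>cmod u - cmod w\<bar> \<le> s" by (simp add: s_def abs_le_iff)
  then have v: "\<bar>v\<bar> \<le> 1" by (simp add: v_def divide_le_eq abs_divide)
  have "s * v = cmod u - cmod w"
    unfolding v_def s_def by (cases "u = 0 \<and> w = 0") (auto simp: add_nonneg_eq_0_iff)
  then have u: "cmod u = s * (1 + v) / 2" and w: "cmod w = s * (1 - v) / 2"
    by (simp_all add: s_def algebra_simps)
  have "cmod (cis \<theta> * u + w) ^ (m + 1) + cmod (u + cis \<theta> * w) ^ (m + 1)
      \<le> s ^ (m + 1) * (2 - (1 - v\<^sup>2) / 32)"
    unfolding \<theta>_def by (rule sum_norm_rotate_powers_le[OF m s v u w])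
  also have "\<dots> \<le> s ^ (m + 1) * (63 / 32 * (1 + v\<^sup>2 / 6))"
  proof (rule mult_left_mono)
    show "2 - (1 - v\<^sup>2) / 32 \<le> 63 / 32 * (1 + v\<^sup>2 / 6)"
      using zero_le_power2[of v] by (simp add: diff_divide_distrib)
  qed (use s in simp)
  also have "\<dots> = 63 / 16 * (s ^ (m + 1) * (1 + v\<^sup>2 / 6) / 2)" by simp
  also have "\<dots> \<le> 63 / 16 * (cmod u powr (1 + 1 / real m) + cmod w powr (1 + 1 / real m)) ^ m"
    unfolding u w by (intro mult_left_mono power_sum_powr_ge s v m) simp
  finally show ?thesis .
qed

section \<open>Hypercontractivity of the agreement kernel\<close>

text \<open>A sign vector indexed by \<open>J\<close> is represented by the subset of \<open>J\<close> where it is positive.\<close>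

definition agree :: "'a set \<Rightarrow> 'a set \<Rightarrow> 'a set \<Rightarrow> nat" where
  "agree J x y = card {j \<in> J. j \<in> x \<longleftrightarrow> j \<in> y}"

lemma agree_insert:
  assumes "finite J" "j \<notin> J" "x \<subseteq> J" "y \<subseteq> J"
  shows "agree (insert j J) x y = Suc (agree J x y)"
    and "agree (insert j J) (insert j x) y = agree J x y"
    and "agree (insert j J) x (insert j y) = agree J x y"
    and "agree (insert j J) (insert j x) (insert j y) = Suc (agree J x y)"
proof -
  have j: "j \<notin> x" "j \<notin> y" using assms by auto
  have "{i \<in> insert j J. i \<in> x \<longleftrightarrow> i \<in> y} = insert j {i \<in> J. i \<in> x \<longleftrightarrow> i \<in> y}"
    "{i \<in> insert j J. i \<in> insert j x \<longleftrightarrow> i \<in> insert j y} = insert j {i \<in> J. i \<in> x \<longleftrightarrow> i \<in> y}"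
    "{i \<in> insert j J. i \<in> insert j x \<longleftrightarrow> i \<in> y} = {i \<in> J. i \<in> x \<longleftrightarrow> i \<in> y}"
    "{i \<in> insert j J. i \<in> x \<longleftrightarrow> i \<in> insert j y} = {i \<in> J. i \<in> x \<longleftrightarrow> i \<in> y}"
    using j assms(2) by auto
  then show "agree (insert j J) x y = Suc (agree J x y)"
    "agree (insert j J) (insert j x) y = agree J x y"
    "agree (insert j J) x (insert j y) = agree J x y"
    "agree (insert j J) (insert j x) (insert j y) = Suc (agree J x y)"
    using assms(1,2) by (simp_all add: agree_def)
qed

lemma sum_Pow_insert:
  assumes "finite J" "j \<notin> J"
  shows "sum f (Pow (insert j J)) = (\<Sum>x\<in>Pow J. f x + f (insert j x))"
proof -
  have "sum f (Pow (insert j J)) = sum f (Pow J) + sum f (insert j ` Pow J)"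
    unfolding Pow_insert using assms by (intro sum.union_disjoint) auto
  also have "sum f (insert j ` Pow J) = (\<Sum>x\<in>Pow J. f (insert j x))"
    using assms by (subst sum.reindex) (auto simp: inj_on_def)
  finally show ?thesis by (simp add: sum.distrib)
qed

lemma convex_on_power_nonneg: "convex_on {0::real..} (\<lambda>x. x ^ n)"
  by (cases "even n") (auto intro: convex_power_odd convex_on_subset[OF convex_power_even])

lemma Minkowski_sum_power_le_pos:
  fixes a b :: "'i \<Rightarrow> real"
  assumes nonneg: "\<And>i. i \<in> I \<Longrightarrow> 0 \<le> a i" "\<And>i. i \<in> I \<Longrightarrow> 0 \<le> b i" and pos: "0 < A" "0 < B"
    and a: "(\<Sum>i\<in>I. a i ^ n) \<le> C * A ^ n" and b: "(\<Sum>i\<in>I. b i ^ n) \<le> C * B ^ n"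
  shows "(\<Sum>i\<in>I. (a i + b i) ^ n) \<le> C * (A + B) ^ n"
proof -
  define t where "t = B / (A + B)"
  have t: "0 \<le> t" "t \<le> 1" using pos by (auto simp: t_def)
  have split: "a i + b i = (A + B) * ((1 - t) * (a i / A) + t * (b i / B))" for i
    using pos by (simp add: t_def divide_simps)
  have convex: "((1 - t) * (a i / A) + t * (b i / B)) ^ n \<le> (1 - t) * (a i / A) ^ n + t * (b i / B) ^ n"
    if "i \<in> I" for i
    using convex_onD[OF convex_on_power_nonneg t, of "a i / A" "b i / B" n] nonneg pos that by simp
  have "(\<Sum>i\<in>I. (a i + b i) ^ n) = (\<Sum>i\<in>I. (A + B) ^ n * ((1 - t) * (a i / A) + t * (b i / B)) ^ n)"
    by (subst split) (simp only: power_mult_distrib)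
  also have "\<dots> \<le> (\<Sum>i\<in>I. (A + B) ^ n * ((1 - t) * (a i / A) ^ n + t * (b i / B) ^ n))"
    using pos by (intro sum_mono mult_left_mono convex) auto
  also have "\<dots> = (A + B) ^ n * ((1 - t) * ((\<Sum>i\<in>I. a i ^ n) / A ^ n) + t * ((\<Sum>i\<in>I. b i ^ n) / B ^ n))"
    by (simp add: power_divide sum.distrib sum_distrib_left sum_divide_distrib distrib_left mult_ac)
  also have "\<dots> \<le> (A + B) ^ n * ((1 - t) * C + t * C)"
    using a b t pos by (intro mult_left_mono add_mono) (auto simp: divide_le_eq)
  finally show ?thesis by (simp add: algebra_simps)
qed

text \<open>The bounds \<open>A\<close> and \<open>B\<close> may vanish, hence the limit.\<close>

lemma Minkowski_sum_power_le:
  fixes a b :: "'i \<Rightarrow> real"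
  assumes "\<And>i. i \<in> I \<Longrightarrow> 0 \<le> a i" "\<And>i. i \<in> I \<Longrightarrow> 0 \<le> b i" and nonneg: "0 \<le> A" "0 \<le> B" "0 \<le> C"
    and a: "(\<Sum>i\<in>I. a i ^ n) \<le> C * A ^ n" and b: "(\<Sum>i\<in>I. b i ^ n) \<le> C * B ^ n"
  shows "(\<Sum>i\<in>I. (a i + b i) ^ n) \<le> C * (A + B) ^ n"
proof (rule tendsto_lowerbound)
  show "((\<lambda>\<delta>. C * ((A + \<delta>) + (B + \<delta>)) ^ n) \<longlongrightarrow> C * (A + B) ^ n) (at_right 0)"
    by (rule tendsto_eq_intros refl | simp)+
  have "(\<Sum>i\<in>I. (a i + b i) ^ n) \<le> C * ((A + \<delta>) + (B + \<delta>)) ^ n" if "\<delta> > 0" for \<delta>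
  proof (rule Minkowski_sum_power_le_pos)
    show "(\<Sum>i\<in>I. a i ^ n) \<le> C * (A + \<delta>) ^ n"
      using that nonneg by (intro order.trans[OF a] mult_left_mono power_mono) auto
    show "(\<Sum>i\<in>I. b i ^ n) \<le> C * (B + \<delta>) ^ n"
      using that nonneg by (intro order.trans[OF b] mult_left_mono power_mono) auto
  qed (use assms that in auto)
  then show "\<forall>\<^sub>F \<delta> in at_right 0. (\<Sum>i\<in>I. (a i + b i) ^ n) \<le> C * ((A + \<delta>) + (B + \<delta>)) ^ n"
    by (rule eventually_at_right_less[THEN eventually_mono])
qed simp

definition agreement_transform :: "real \<Rightarrow> 'a set \<Rightarrow> ('a set \<Rightarrow> complex) \<Rightarrow> 'a set \<Rightarrow> complex" where
  "agreement_transform \<theta> J g x = (\<Sum>y\<in>Pow J. g y * cis (\<theta> * agree J x y))"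

lemma agreement_transform_insert:
  fixes g :: "'a set \<Rightarrow> complex"
  assumes "finite J" "j \<notin> J" "x \<subseteq> J"
  defines "g' \<equiv> \<lambda>y. g (insert j y)"
  shows "agreement_transform \<theta> (insert j J) g x
      = cis \<theta> * agreement_transform \<theta> J g x + agreement_transform \<theta> J g' x"
    and "agreement_transform \<theta> (insert j J) g (insert j x)
      = agreement_transform \<theta> J g x + cis \<theta> * agreement_transform \<theta> J g' x"
proof -
  have "cis (\<theta> * Suc i) = cis \<theta> * cis (\<theta> * i)" for i
    by (simp add: cis_mult algebra_simps)
  then show "agreement_transform \<theta> (insert j J) g x
      = cis \<theta> * agreement_transform \<theta> J g x + agreement_transform \<theta> J g' x"
    "agreement_transform \<theta> (insert j J) g (insert j x)
      = agreement_transform \<theta> J g x + cis \<theta> * agreement_transform \<theta> J g' x"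
    using assms(1-3) unfolding agreement_transform_def g'_def
    by (simp_all add: sum_Pow_insert agree_insert sum.distrib sum_distrib_left mult_ac del: of_nat_Suc)
qed

lemma agreement_transform_hypercontractive:
  fixes g :: "'a set \<Rightarrow> complex" and m :: nat
  defines "\<theta> \<equiv> 1 / sqrt (real m)"
  assumes m: "m \<ge> 1" and J: "finite J"
  shows "(\<Sum>x\<in>Pow J. cmod (agreement_transform \<theta> J g x) ^ (m + 1))
    \<le> (63 / 16) ^ card J * (\<Sum>y\<in>Pow J. cmod (g y) powr (1 + 1 / real m)) ^ m"
  using J
proof (induction J arbitrary: g)
  case empty
  show ?case
    using powr_one_plus_inverse_power[of "cmod (g {})" m] m
    by (simp add: agreement_transform_def agree_def)
next
  case (insert j J)
  define N where "N z = cmod z powr (1 + 1 / real m)" for z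
  have N_power: "N z ^ m = cmod z ^ (m + 1)" for z
    unfolding N_def by (rule powr_one_plus_inverse_power) (use m in auto)
  define g' where "g' y = g (insert j y)" for y
  define u where "u = agreement_transform \<theta> J g"
  define w where "w = agreement_transform \<theta> J g'"
  have "(\<Sum>x\<in>Pow (insert j J). cmod (agreement_transform \<theta> (insert j J) g x) ^ (m + 1))
      = (\<Sum>x\<in>Pow J. cmod (cis \<theta> * u x + w x) ^ (m + 1) + cmod (u x + cis \<theta> * w x) ^ (m + 1))"
    using insert.hyps agreement_transform_insert[of J j _ \<theta> g]
    by (simp add: sum_Pow_insert u_def w_def g'_def[abs_def] del: power_Suc)
  also have "\<dots> \<le> (\<Sum>x\<in>Pow J. 63 / 16 * (N (u x) + N (w x)) ^ m)"
    unfolding \<theta>_def N_def by (intro sum_mono two_point_inequality m)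
  also have "\<dots> = 63 / 16 * (\<Sum>x\<in>Pow J. (N (u x) + N (w x)) ^ m)"
    by (simp add: sum_distrib_left)
  also have "\<dots> \<le> 63 / 16 * ((63 / 16) ^ card J * ((\<Sum>y\<in>Pow J. N (g y)) + (\<Sum>y\<in>Pow J. N (g' y))) ^ m)"
  proof (rule mult_left_mono[OF Minkowski_sum_power_le])
    show "(\<Sum>x\<in>Pow J. N (u x) ^ m) \<le> (63 / 16) ^ card J * (\<Sum>y\<in>Pow J. N (g y)) ^ m"
      unfolding N_power u_def unfolding N_def by (rule insert.IH)
    show "(\<Sum>x\<in>Pow J. N (w x) ^ m) \<le> (63 / 16) ^ card J * (\<Sum>y\<in>Pow J. N (g' y)) ^ m"
      unfolding N_power w_def unfolding N_def by (rule insert.IH)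
  qed (auto simp: N_def intro!: sum_nonneg)
  also have "(\<Sum>y\<in>Pow J. N (g y)) + (\<Sum>y\<in>Pow J. N (g' y)) = (\<Sum>y\<in>Pow (insert j J). N (g y))"
    using insert.hyps by (simp add: sum_Pow_insert g'_def sum.distrib)
  finally show ?case using insert.hyps by (simp add: N_def)
qed

section \<open>Two-party Gap Hamming\<close>

lemma power_sum_le_card_power_mult:
  fixes a :: "'i \<Rightarrow> real"
  assumes "\<And>i. i \<in> I \<Longrightarrow> 0 \<le> a i"
  shows "(\<Sum>i\<in>I. a i) ^ (n + 1) \<le> real (card I) ^ n * (\<Sum>i\<in>I. a i ^ (n + 1))"
proof (cases "finite I \<and> I \<noteq> {}")
  case True
  then have c: "real (card I) > 0" by (simp add: card_gt_0_iff)
  have "(\<Sum>i\<in>I. (1 / card I) *\<^sub>R a i) ^ (n + 1) \<le> (\<Sum>i\<in>I. (1 / card I) * a i ^ (n + 1))"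
    using assms True c by (intro convex_on_sum[OF _ _ convex_on_power_nonneg]) auto
  then have "((\<Sum>i\<in>I. a i) / card I) ^ (n + 1) \<le> (\<Sum>i\<in>I. a i ^ (n + 1)) / card I"
    by (simp add: sum_divide_distrib)
  then show ?thesis using c by (simp add: power_divide field_simps)
qed auto

lemma norm_agreement_kernel_sum_power_le:
  fixes J :: "'a set"
  defines "m \<equiv> card J"
  assumes J: "finite J" "J \<noteq> {}" and AB: "A \<subseteq> Pow J" "B \<subseteq> Pow J"
  shows "cmod (\<Sum>x\<in>A. \<Sum>y\<in>B. cis (agree J x y / sqrt m)) ^ (m + 1)
    \<le> (63 / 16) ^ m * (real (card A) * real (card B)) ^ m"
proof -
  have m: "m \<ge> 1" using J by (simp add: m_def Suc_le_eq card_gt_0_iff)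
  define S where "S x = (\<Sum>y\<in>B. cis (agree J x y / sqrt m))" for x
  have restrict: "(\<Sum>y\<in>Pow J. indicator B y * f y) = sum f B" for f :: "'a set \<Rightarrow> 'c::comm_semiring_1"
    using AB J by (simp add: indicator_def sum.If_cases if_distrib[of "\<lambda>x. x * _"] Int_absorb1
      cong: if_cong)
  have mass: "(\<Sum>y\<in>Pow J. cmod (indicator B y) powr (1 + 1 / real m)) = card B"
  proof -
    have "cmod (indicator B y) powr (1 + 1 / real m) = indicator B y * 1" for y
      by (simp add: indicator_def)
    then show ?thesis by (simp only: restrict) simp
  qed
  have L: "(\<Sum>x\<in>Pow J. cmod (S x) ^ (m + 1)) \<le> (63 / 16) ^ m * real (card B) ^ m"
    using agreement_transform_hypercontractive[OF m J(1), of "indicator B"]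
    unfolding agreement_transform_def mass restrict m_def[symmetric] by (simp add: S_def)
  have "cmod (\<Sum>x\<in>A. S x) ^ (m + 1) \<le> (\<Sum>x\<in>A. cmod (S x)) ^ (m + 1)"
    by (intro power_mono norm_sum) auto
  also have "\<dots> \<le> card A ^ m * (\<Sum>x\<in>A. cmod (S x) ^ (m + 1))"
    using power_sum_le_card_power_mult[of A "\<lambda>x. cmod (S x)" m] by simp
  also have "\<dots> \<le> card A ^ m * ((63 / 16) ^ m * real (card B) ^ m)"
    using AB J by (intro mult_left_mono order.trans[OF sum_mono2 L]) auto
  finally show ?thesis by (simp add: S_def power_mult_distrib mult_ac)
qed

lemma weighted_arith_geo_mean:
  fixes x a b :: real
  assumes "0 \<le> x" "0 \<le> a" "0 \<le> b" "x ^ (n + 1) \<le> a ^ n * b"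
  shows "x \<le> (real n * a + b) / (real n + 1)"
proof -
  define y where "y i = (if i < n then a else b)" for i
  have "(\<Prod>i\<le>n. y i) = a ^ n * b" "(\<Sum>i\<le>n. y i) = real n * a + b"
    unfolding lessThan_Suc_atMost[symmetric] by (simp_all add: y_def)
  then have "(a ^ n * b) powr (1 / (real n + 1)) \<le> (real n * a + b) / (real n + 1)"
    using arith_geom_mean[of "{..n}" y] assms(2,3) by (simp add: y_def add_ac flip: sum_divide_distrib)
  moreover have "x = (x ^ (n + 1)) powr (1 / (real n + 1))"
    using assms(1) powr_realpow[of x "n + 1"] powr_powr[of x "real (n + 1)" "1 / (real n + 1)"]
    by (cases "x = 0") (simp_all add: add_ac)
  then have "x \<le> (a ^ n * b) powr (1 / (real n + 1))"
    using assms powr_mono2[of "1 / (real n + 1)" "x ^ (n + 1)" "a ^ n * b"] by simp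
  ultimately show ?thesis by linarith
qed

text \<open>Linearized, with \<open>\<beta>\<close> free, so that the bound can be added up over the rectangles of a partition.\<close>

lemma norm_agreement_kernel_sum_le:
  fixes J :: "'a set" and c \<beta> :: real
  defines "m \<equiv> card J"
  assumes J: "finite J" "J \<noteq> {}" and AB: "A \<subseteq> Pow J" "B \<subseteq> Pow J"
    and c: "0 \<le> c" "0 \<le> \<beta>" "(63 / 16) ^ m \<le> c ^ m * \<beta>"
  shows "cmod (\<Sum>x\<in>A. \<Sum>y\<in>B. cis (agree J x y / sqrt m))
    \<le> (real m * (c * (real (card A) * real (card B))) + \<beta>) / (real m + 1)"
proof (rule weighted_arith_geo_mean)
  have "cmod (\<Sum>x\<in>A. \<Sum>y\<in>B. cis (agree J x y / sqrt m)) ^ (m + 1)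
      \<le> (63 / 16) ^ m * (real (card A) * real (card B)) ^ m"
    unfolding m_def by (rule norm_agreement_kernel_sum_power_le[OF J AB])
  also have "\<dots> \<le> c ^ m * \<beta> * (real (card A) * real (card B)) ^ m"
    by (intro mult_right_mono c) simp
  finally show "cmod (\<Sum>x\<in>A. \<Sum>y\<in>B. cis (agree J x y / sqrt m)) ^ (m + 1)
      \<le> (c * (real (card A) * real (card B))) ^ m * \<beta>"
    by (simp add: power_mult_distrib mult_ac)
qed (use c in auto)

lemma card_aligned_le_norm_sum:
  fixes f :: "'a \<Rightarrow> complex" and \<delta> :: real
  assumes fin: "finite \<Omega>" and R: "R \<subseteq> \<Omega>" and "cmod e = 1"
    and f: "\<And>z. z \<in> \<Omega> \<Longrightarrow> cmod (f z) \<le> 1" and aligned: "\<And>z. z \<in> R \<Longrightarrow> 1 - \<delta> \<le> Re (e * f z)"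
  shows "(2 - \<delta>) * card R \<le> card \<Omega> + cmod (sum f \<Omega>)"
proof -
  have finR: "finite R" using fin R by (rule finite_subset[rotated])
  have "- 1 \<le> Re (e * f z)" if "z \<in> \<Omega>" for z
    using f[OF that] abs_Re_le_cmod[of "e * f z"] \<open>cmod e = 1\<close> by (simp add: norm_mult)
  then have "real (card (\<Omega> - R)) * - 1 \<le> (\<Sum>z\<in>\<Omega> - R. Re (e * f z))"
    by (intro sum_bounded_below) auto
  moreover have "real (card R) * (1 - \<delta>) \<le> (\<Sum>z\<in>R. Re (e * f z))"
    by (intro sum_bounded_below aligned)
  moreover have "(\<Sum>z\<in>\<Omega> - R. Re (e * f z)) + (\<Sum>z\<in>R. Re (e * f z)) = Re (e * sum f \<Omega>)"
    using sum.subset_diff[OF R fin, of "\<lambda>z. Re (e * f z)"] by (simp only: sum_distrib_left Re_sum)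
  moreover have "Re (e * sum f \<Omega>) \<le> cmod (sum f \<Omega>)"
    using complex_Re_le_cmod[of "e * sum f \<Omega>"] \<open>cmod e = 1\<close> by (simp add: norm_mult)
  ultimately have "real (card R) * (1 - \<delta>) - real (card (\<Omega> - R)) \<le> cmod (sum f \<Omega>)" by linarith
  moreover have "real (card (\<Omega> - R)) = real (card \<Omega>) - real (card R)"
    using fin R finR by (simp add: card_Diff_subset card_mono of_nat_diff)
  ultimately show ?thesis by (simp add: algebra_simps)
qed

lemma card_close_agreements_le:
  fixes J :: "'a set"
  defines "m \<equiv> card J"
  assumes m: "m > 0" and fin: "finite A" "finite B" and R: "R \<subseteq> A \<times> B"
    and close: "\<And>x y x' y'. (x, y) \<in> R \<Longrightarrow> (x', y') \<in> R \<Longrightarrow>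
      \<bar>real (agree J x y) - real (agree J x' y')\<bar> \<le> sqrt m / 32"
  shows "(2 - 1 / 2048) * real (card R)
    \<le> real (card A) * real (card B) + cmod (\<Sum>x\<in>A. \<Sum>y\<in>B. cis (agree J x y / sqrt m))"
proof (cases "R = {}")
  case False
  then obtain x0 y0 where z0: "(x0, y0) \<in> R" by auto
  define K where "K = (\<lambda>(x, y). cis (agree J x y / sqrt m))"
  have "1 - 1 / 2048 \<le> Re (cnj (K (x0, y0)) * K z)" if "z \<in> R" for z
  proof -
    obtain x y where z: "z = (x, y)" by (cases z)
    define D where "D = (real (agree J x y) - real (agree J x0 y0)) / sqrt m"
    have "\<bar>D\<bar> \<le> 1 / 32"
      using close[of x y x0 y0] that z0 z m by (simp add: D_def abs_divide pos_divide_le_eq)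
    then have "D\<^sup>2 \<le> (1 / 32)\<^sup>2" by (metis abs_ge_zero power2_abs power_mono)
    then have "1 - 1 / 2048 \<le> cos D"
      using cos_ge_quadratic[of D] by (simp add: power_divide)
    also have "cos D = Re (cnj (K (x0, y0)) * K z)"
      by (simp add: K_def z D_def cis_cnj cis_mult diff_divide_distrib)
    finally show ?thesis .
  qed
  then have "(2 - 1 / 2048) * real (card R) \<le> card (A \<times> B) + cmod (sum K (A \<times> B))"
    using fin R by (intro card_aligned_le_norm_sum[where e = "cnj (K (x0, y0))"]) (auto simp: K_def)
  then show ?thesis
    by (simp add: K_def card_cartesian_product sum.cartesian_product)
qed simp

lemma two_power_mult_power_le:
  assumes "200 * t \<le> m" "m \<ge> 1"
  shows "2 ^ t * (63 / 64) ^ m \<le> (199 / 200 :: real) ^ (m + 1)"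
proof -
  have "2 \<le> (1 + 1 / 200 :: real) ^ 200"
    using Bernoulli_inequality[of "1 / 200 :: real" 200] by simp
  then have "2 ^ t \<le> ((201 / 200 :: real) ^ 200) ^ t" by (intro power_mono) auto
  also have "\<dots> \<le> (201 / 200) ^ m"
    unfolding power_mult[symmetric] using assms by (intro power_increasing) auto
  finally have "2 ^ t * (63 / 64) ^ m \<le> (201 / 200) ^ m * (63 / 64 :: real) ^ m"
    by (rule mult_right_mono) simp
  also have "\<dots> \<le> ((199 / 200)\<^sup>2) ^ m"
    unfolding power_mult_distrib[symmetric] by (intro power_mono) (auto simp: power2_eq_square)
  also have "\<dots> \<le> (199 / 200) ^ (m + 1)"
    unfolding power_mult[symmetric] using assms by (intro power_decreasing) auto
  finally show ?thesis .
qed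

primrec bits_by :: "nat set \<Rightarrow> 'x protocol \<Rightarrow> (nat \<Rightarrow> 'x) \<Rightarrow> nat" where
  "bits_by Z (Output v) X = 0"
| "bits_by Z (Speak i f P Q) X =
     (if i \<in> Z then 1 else 0) + (if f (X i) then bits_by Z P X else bits_by Z Q X)"

lemma card_filter_plus_card_filter_not:
  "finite A \<Longrightarrow> card {x \<in> A. P x} + card {x \<in> A. \<not> P x} = card A"
  by (subst card_Un_disjoint[symmetric]) (auto intro: arg_cong[where f = card])

locale two_party_inputs =
  fixes X :: "'b \<Rightarrow> 'c \<Rightarrow> nat \<Rightarrow> 'x" and a b :: nat and acc :: "'b \<Rightarrow> 'c \<Rightarrow> real \<Rightarrow> bool"
  assumes input_a: "\<And>x y y'. X x y a = X x y' a"
    and input_b: "\<And>x x' y. X x y b = X x' y b"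
    and input_other: "\<And>i x y x' y'. i \<noteq> a \<Longrightarrow> i \<noteq> b \<Longrightarrow> X x y i = X x' y' i"
begin

definition accepted_short :: "'x protocol \<Rightarrow> nat \<Rightarrow> 'b set \<Rightarrow> 'c set \<Rightarrow> ('b \<times> 'c) set" where
  "accepted_short P t A B =
     {(x, y) \<in> A \<times> B. acc x y (run P (X x y)) \<and> bits_by {a, b} P (X x y) \<le> t}"

lemma accepted_short_Speak_pair:
  assumes "i \<in> {a, b}" "finite A" "finite B"
  obtains A1 A2 B1 B2 where "A1 \<subseteq> A" "A2 \<subseteq> A" "B1 \<subseteq> B" "B2 \<subseteq> B"
    and "card A1 * card B1 + card A2 * card B2 = card A * card B"
    and "accepted_short (Speak i f P Q) (Suc t) A B
      = accepted_short P t A1 B1 \<union> accepted_short Q t A2 B2"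
proof (cases "i = a")
  case True
  define g where "g x = f (X x undefined a)" for x
  have "f (X x y a) = g x" for x y unfolding g_def using input_a by metis
  then have "accepted_short (Speak i f P Q) (Suc t) A B
      = accepted_short P t {x \<in> A. g x} B \<union> accepted_short Q t {x \<in> A. \<not> g x} B"
    by (auto simp: accepted_short_def True)
  then show thesis
    using card_filter_plus_card_filter_not[OF assms(2), of g]
    by (intro that[of "{x \<in> A. g x}" "{x \<in> A. \<not> g x}" B B]) (auto simp flip: distrib_right)
next
  case False
  then have i: "i = b" using assms(1) by simp
  define g where "g y = f (X undefined y b)" for y
  have "f (X x y b) = g y" for x y unfolding g_def using input_b by metis
  then have "accepted_short (Speak i f P Q) (Suc t) A B
      = accepted_short P t A {y \<in> B. g y} \<union> accepted_short Q t A {y \<in> B. \<not> g y}"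
    by (auto simp: accepted_short_def i)
  then show thesis
    using card_filter_plus_card_filter_not[OF assms(3), of g]
    by (intro that[of A A "{y \<in> B. g y}" "{y \<in> B. \<not> g y}"]) (auto simp flip: distrib_left)
qed

lemma accepted_short_Speak_other:
  assumes "i \<noteq> a" "i \<noteq> b"
  obtains z where "accepted_short (Speak i f P Q) t A B = accepted_short (if f z then P else Q) t A B"
proof -
  define z where "z = X undefined undefined i"
  have "X x y i = z" for x y unfolding z_def using assms by (rule input_other)
  then show thesis using assms by (intro that[of z]) (auto simp: accepted_short_def)
qed

text \<open>
  With the inputs of all other parties fixed, the pairs on which \<open>a\<close> and \<open>b\<close> write at most \<open>t\<close> bits split
  into at most \<open>2 ^ t\<close> rectangles with constant output.
\<close>

lemma card_accepted_short_le:
  assumes nonneg: "0 \<le> \<theta>" "0 \<le> \<kappa>" and "finite A" "finite B"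
    and "\<And>A' B' v. A' \<subseteq> A \<Longrightarrow> B' \<subseteq> B \<Longrightarrow>
      real (card {(x, y) \<in> A' \<times> B'. acc x y v}) \<le> \<kappa> * (real (card A') * real (card B')) + \<theta>"
  shows "real (card (accepted_short P t A B)) \<le> \<kappa> * (real (card A) * real (card B)) + 2 ^ t * \<theta>"
  using assms(3-)
proof (induction P arbitrary: A B t)
  case (Output v)
  have "real (card {(x, y) \<in> A \<times> B. acc x y v}) \<le> \<kappa> * (real (card A) * real (card B)) + \<theta>"
    using Output(3) by blast
  also have "\<dots> \<le> \<kappa> * (real (card A) * real (card B)) + 2 ^ t * \<theta>"
    using nonneg mult_right_mono[of 1 "2 ^ t" \<theta>] by simp
  finally show ?case by (simp add: accepted_short_def)
next
  case (Speak i f P Q)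
  consider "i \<in> {a, b}" "t = 0" | s where "i \<in> {a, b}" "t = Suc s" | "i \<notin> {a, b}"
    by (cases t) auto
  then show ?case
  proof cases
    case 1
    then have "accepted_short (Speak i f P Q) t A B = {}" by (auto simp: accepted_short_def)
    then show ?thesis using nonneg by simp
  next
    case (2 s)
    obtain A1 A2 B1 B2 where sub: "A1 \<subseteq> A" "A2 \<subseteq> A" "B1 \<subseteq> B" "B2 \<subseteq> B"
      and area: "card A1 * card B1 + card A2 * card B2 = card A * card B"
      and short: "accepted_short (Speak i f P Q) (Suc s) A B
        = accepted_short P s A1 B1 \<union> accepted_short Q s A2 B2"
      using accepted_short_Speak_pair[OF 2(1) Speak.prems(1,2)] .
    have "real (card (accepted_short (Speak i f P Q) t A B))
        \<le> real (card (accepted_short P s A1 B1)) + real (card (accepted_short Q s A2 B2))"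
      unfolding 2(2) short by (metis card_Un_le of_nat_add of_nat_le_iff)
    also have "\<dots> \<le> (\<kappa> * (real (card A1) * real (card B1)) + 2 ^ s * \<theta>)
        + (\<kappa> * (real (card A2) * real (card B2)) + 2 ^ s * \<theta>)"
      using sub Speak.prems by (intro add_mono Speak.IH) (auto intro: finite_subset)
    also have "\<dots> = \<kappa> * real (card A1 * card B1 + card A2 * card B2) + 2 ^ t * \<theta>"
      by (simp add: 2(2) algebra_simps)
    finally show ?thesis by (simp add: area)
  next
    case 3
    then obtain z where "accepted_short (Speak i f P Q) t A B
        = accepted_short (if f z then P else Q) t A B"
      using accepted_short_Speak_other by blast
    then show ?thesis
      using Speak.IH[OF Speak.prems, of t] by simp
  qed
qed

end

locale gap_hamming = two_party_inputs X a b acc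
  for X :: "'a set \<Rightarrow> 'a set \<Rightarrow> nat \<Rightarrow> 'x" and a b acc +
  fixes J :: "'a set"
  assumes finite_nonempty: "finite J" "J \<noteq> {}"
    and acc_close: "\<And>x y x' y' v. acc x y v \<Longrightarrow> acc x' y' v \<Longrightarrow>
      real (agree J x y) - real (agree J x' y') \<le> sqrt (card J) / 32"
begin

lemma card_accepted_rectangle_le:
  fixes c \<beta> :: real
  assumes AB: "A \<subseteq> Pow J" "B \<subseteq> Pow J"
    and c: "0 \<le> c" "0 \<le> \<beta>" "(63 / 16) ^ card J \<le> c ^ card J * \<beta>"
  shows "real (card {(x, y) \<in> A \<times> B. acc x y v})
    \<le> 2048 / 4095 * ((1 + card J * c / (card J + 1)) * (real (card A) * real (card B)) + \<beta> / (card J + 1))"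
proof -
  have rescale: "r \<le> 2048 / 4095 * s" if "(2 - 1 / 2048) * r \<le> s" for r s :: real
    using that by simp
  have "finite A" "finite B" using AB finite_nonempty by (auto intro: finite_subset)
  moreover have "\<bar>real (agree J x y) - real (agree J x' y')\<bar> \<le> sqrt (card J) / 32"
    if "acc x y v" "acc x' y' v" for x y x' y'
    using acc_close[of x y v x' y'] acc_close[of x' y' v x y] that by linarith
  ultimately have "(2 - 1 / 2048) * real (card {(x, y) \<in> A \<times> B. acc x y v})
      \<le> real (card A) * real (card B) + cmod (\<Sum>x\<in>A. \<Sum>y\<in>B. cis (agree J x y / sqrt (card J)))"
    using finite_nonempty by (intro card_close_agreements_le) (auto simp: card_gt_0_iff)
  also have "\<dots> \<le> real (card A) * real (card B)
      + (card J * (c * (real (card A) * real (card B))) + \<beta>) / (card J + 1)"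
    using norm_agreement_kernel_sum_le[OF finite_nonempty AB c] by (simp add: add_ac)
  also have "\<dots> = (1 + card J * c / (card J + 1)) * (real (card A) * real (card B)) + \<beta> / (card J + 1)"
    by (simp add: algebra_simps add_divide_distrib)
  finally show ?thesis by (rule rescale)
qed

lemma card_accepted_short_cube_le:
  assumes t: "200 * t \<le> card J"
  shows "card (accepted_short P t (Pow J) (Pow J)) \<le> 511 / 512 * 4 ^ card J"
proof -
  define m where "m = card J"
  have m: "m \<ge> 1" using finite_nonempty by (simp add: m_def Suc_le_eq card_gt_0_iff)
  define c :: real where "c = 199 / 200"
  define \<beta> where "\<beta> = c * 4 ^ m / 2 ^ t" \<comment> \<open>equality in AM-GM at the average area \<open>4 ^ m / 2 ^ t\<close>\<close>
  define \<kappa> where "\<kappa> = 1 + m * c / (m + 1)"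
  define \<theta> where "\<theta> = \<beta> / (m + 1)"
  have nonneg: "0 \<le> c" "0 \<le> \<beta>" "0 \<le> \<kappa>" "0 \<le> \<theta>"
    by (simp_all add: c_def \<beta>_def \<kappa>_def \<theta>_def)
  have "(63 / 16 :: real) ^ m = (2 ^ t * (63 / 64) ^ m) * 4 ^ m / 2 ^ t"
    by (simp flip: power_mult_distrib)
  also have "\<dots> \<le> c ^ (m + 1) * 4 ^ m / 2 ^ t"
    using two_power_mult_power_le[OF t[folded m_def] m]
    by (intro divide_right_mono mult_right_mono) (auto simp: c_def)
  finally have \<beta>: "(63 / 16) ^ m \<le> c ^ m * \<beta>" by (simp add: \<beta>_def mult_ac)
  have "real (card {(x, y) \<in> A \<times> B. acc x y v})
      \<le> 2048 / 4095 * \<kappa> * (real (card A) * real (card B)) + 2048 / 4095 * \<theta>"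
    if "A \<subseteq> Pow J" "B \<subseteq> Pow J" for A B v
    using card_accepted_rectangle_le[OF that nonneg(1,2) \<beta>[unfolded m_def]]
    by (simp only: \<kappa>_def \<theta>_def m_def mult.assoc flip: distrib_left)
  then have "real (card (accepted_short P t (Pow J) (Pow J)))
      \<le> 2048 / 4095 * \<kappa> * (real (card (Pow J)) * real (card (Pow J))) + 2 ^ t * (2048 / 4095 * \<theta>)"
    using finite_nonempty(1) nonneg by (intro card_accepted_short_le) auto
  also have "\<dots> = 2048 / 4095 * (\<kappa> * 4 ^ m + 2 ^ t * \<theta>)"
    using finite_nonempty(1) by (simp add: card_Pow m_def[symmetric] distrib_left flip: power_mult_distrib)
  also have "2 ^ t * \<theta> = c * 4 ^ m / (real m + 1)"
    by (simp add: \<theta>_def \<beta>_def add_ac)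
  also have "2048 / 4095 * (\<kappa> * 4 ^ m + c * 4 ^ m / (real m + 1))
      = 2048 / 4095 * ((1 + c * (real m + 1) / (real m + 1)) * 4 ^ m)"
    by (simp add: \<kappa>_def algebra_simps add_divide_distrib)
  also have "\<dots> = 2048 / 4095 * (1 + c) * 4 ^ m" by simp
  also have "\<dots> \<le> 511 / 512 * 4 ^ card J"
    unfolding m_def by (intro mult_right_mono) (auto simp: c_def)
  finally show ?thesis .
qed

end

section \<open>The hard input distribution\<close>

definition pair :: "nat \<Rightarrow> nat set" where
  "pair r = {2 * r, 2 * r + 1}"

lemma sum_bits_by_pairs_le: "(\<Sum>r<h. bits_by (pair r) P X) \<le> bits P X"
proof (induction P)
  case (Speak i f P Q)
  have "(\<Sum>r<h. if i \<in> pair r then 1 else 0 :: nat) = card {r. r < h \<and> i \<in> pair r}"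
    by (simp add: sum.If_cases Int_def)
  also have "\<dots> \<le> card {i div 2}" by (intro card_mono) (auto simp: pair_def)
  finally show ?case using Speak by (auto simp: sum.distrib)
qed simp

text \<open>A column of signs is represented by the set of parties holding \<open>1\<close> in it, a matrix by its columns.\<close>

definition balanced_columns :: "nat \<Rightarrow> nat set set" where
  "balanced_columns h = {c. c \<subseteq> {..<2 * h} \<and> h \<le> card c + 1 \<and> card c \<le> h + 1}"

definition hard_family :: "nat \<Rightarrow> nat \<Rightarrow> (nat \<Rightarrow> nat set) set" where
  "hard_family h n = {..<n} \<rightarrow>\<^sub>E balanced_columns h"

definition unbalanced :: "nat \<Rightarrow> nat \<Rightarrow> (nat \<Rightarrow> nat set) \<Rightarrow> nat" where
  "unbalanced h n S = card {j. j < n \<and> card (S j) \<noteq> h}"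

text \<open>
  In these columns the parties outside \<open>pair r\<close> sum to 0, so both entries of the pair can be chosen
  freely without leaving the family.
\<close>

definition free_columns :: "nat \<Rightarrow> nat \<Rightarrow> nat \<Rightarrow> (nat \<Rightarrow> nat set) \<Rightarrow> nat set" where
  "free_columns h n r S = {j. j < n \<and> card (S j - pair r) = h - 1}"

lemma finite_balanced_columns: "finite (balanced_columns h)"
  by (rule finite_subset[of _ "Pow {..<2 * h}"]) (auto simp: balanced_columns_def)

lemma finite_hard_family: "finite (hard_family h n)"
  unfolding hard_family_def by (intro finite_PiE finite_balanced_columns) auto

lemma hard_family_nonempty: "hard_family h n \<noteq> {}"
proof -
  have "{..<h} \<in> balanced_columns h" by (auto simp: balanced_columns_def)
  then show ?thesis by (auto simp: hard_family_def PiE_eq_empty_iff)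
qed

lemma balanced_column_hard_family: "S \<in> hard_family h n \<Longrightarrow> j < n \<Longrightarrow> S j \<in> balanced_columns h"
  by (auto simp: hard_family_def)

lemma finite_free_columns: "finite (free_columns h n r S)"
  by (simp add: free_columns_def)

lemma free_columns_subset: "free_columns h n r S \<subseteq> {..<n}"
  by (auto simp: free_columns_def)

lemma unbalanced_le: "unbalanced h n S \<le> n"
  unfolding unbalanced_def using card_mono[of "{..<n}" "{j. j < n \<and> card (S j) \<noteq> h}"] by auto

subsection \<open>Abundance of free columns\<close>

lemma central_binomial_Suc_le: "(2 * Suc g) choose Suc g \<le> 4 * ((2 * g) choose g)"
proof (cases g)
  case (Suc f)
  have "(2 * Suc g) choose Suc g = ((2 * g) choose Suc g) + 2 * ((2 * g) choose g) + ((2 * g) choose f)"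
    by (simp add: Suc)
  then show ?thesis using binomial_maximum'[of g "Suc g"] binomial_maximum'[of g f] by simp
qed simp

lemma card_balanced_columns_le:
  assumes "h \<ge> 1"
  shows "card (balanced_columns h) \<le> 12 * ((2 * (h - 1)) choose (h - 1))"
proof -
  define layer where "layer i = {c. c \<subseteq> {..<2 * h} \<and> card c = i}" for i
  have "balanced_columns h = (\<Union>i\<in>{h - 1, h, h + 1}. layer i)"
    using assms by (auto simp: balanced_columns_def layer_def)
  also have "card \<dots> \<le> (\<Sum>i\<in>{h - 1, h, h + 1}. card (layer i))"
    by (intro card_UN_le) auto
  also have "\<dots> = (\<Sum>i\<in>{h - 1, h, h + 1}. (2 * h) choose i)"
    by (intro sum.cong) (auto simp: layer_def n_subsets)
  also have "\<dots> \<le> (\<Sum>i\<in>{h - 1, h, h + 1}. (2 * h) choose h)"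
    by (intro sum_mono binomial_maximum')
  also have "\<dots> = 3 * ((2 * h) choose h)" using assms by (cases h) auto
  also have "\<dots> \<le> 12 * ((2 * (h - 1)) choose (h - 1))"
    using central_binomial_Suc_le[of "h - 1"] assms by simp
  finally show ?thesis .
qed

lemma card_free_balanced_columns_ge:
  assumes "r < h"
  shows "4 * ((2 * (h - 1)) choose (h - 1)) \<le> card {c \<in> balanced_columns h. card (c - pair r) = h - 1}"
proof -
  define D where "D = {d. d \<subseteq> {..<2 * h} - pair r \<and> card d = h - 1}"
  have pair: "pair r \<subseteq> {..<2 * h}" "card (pair r) = 2" "finite (pair r)"
    using assms by (auto simp: pair_def)
  have "card D = (2 * (h - 1)) choose (h - 1)"
    unfolding D_def using pair by (subst n_subsets) (auto simp: card_Diff_subset diff_mult_distrib2)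
  then have "4 * ((2 * (h - 1)) choose (h - 1)) = card (Pow (pair r) \<times> D)"
    using pair by (simp add: card_cartesian_product card_Pow)
  also have "\<dots> = card ((\<lambda>(u, d). u \<union> d) ` (Pow (pair r) \<times> D))"
    by (intro card_image[symmetric] inj_onI) (auto simp: D_def)
  also have "\<dots> \<le> card {c \<in> balanced_columns h. card (c - pair r) = h - 1}"
  proof (intro card_mono subsetI)
    fix c assume "c \<in> (\<lambda>(u, d). u \<union> d) ` (Pow (pair r) \<times> D)"
    then obtain u d where c: "c = u \<union> d" and u: "u \<subseteq> pair r" and d: "d \<in> D" by auto
    have "finite d" "u \<inter> d = {}" "finite u" "card u \<le> 2" and diff: "c - pair r = d"
      using u d pair card_mono[of "pair r" u] by (auto simp: c D_def intro: finite_subset)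
    then have "card c = card u + card d" by (simp add: c card_Un_disjoint)
    then show "c \<in> {c \<in> balanced_columns h. card (c - pair r) = h - 1}"
      using u d pair diff \<open>card u \<le> 2\<close> assms by (auto simp: balanced_columns_def D_def c)
  qed (simp add: finite_balanced_columns)
  finally show ?thesis .
qed

lemma card_PiE_coordinate:
  assumes "finite I" "j \<in> I" "C \<subseteq> B"
  shows "card {S \<in> I \<rightarrow>\<^sub>E B. S j \<in> C} * card B = card C * card (I \<rightarrow>\<^sub>E B)"
proof -
  have "{S \<in> I \<rightarrow>\<^sub>E B. S j \<in> C} = PiE I (\<lambda>i. if i = j then C else B)"
  proof (intro set_eqI iffI)
    fix S assume S: "S \<in> PiE I (\<lambda>i. if i = j then C else B)"
    have "S i \<in> B" if "i \<in> I" for i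
      using PiE_mem[OF S that] assms(3) by (auto split: if_splits)
    moreover have "S j \<in> C" using PiE_mem[OF S assms(2)] by simp
    ultimately show "S \<in> {S \<in> I \<rightarrow>\<^sub>E B. S j \<in> C}" using S by (simp add: PiE_iff)
  qed (auto simp: PiE_iff)
  then have "card {S \<in> I \<rightarrow>\<^sub>E B. S j \<in> C} = card C * card B ^ (card I - 1)"
    using assms by (simp add: card_PiE prod.remove[of _ j])
  moreover have "card I > 0" using assms(1,2) by (auto simp: card_gt_0_iff)
  then have "card (I \<rightarrow>\<^sub>E B) = card B * card B ^ (card I - 1)"
    using assms(1) by (cases "card I") (simp_all add: card_PiE)
  ultimately show ?thesis by simp
qed

lemma card_free_column_ge:
  assumes "r < h" "j < n"
  shows "card (hard_family h n) \<le> 3 * card {S \<in> hard_family h n. j \<in> free_columns h n r S}"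
proof -
  define B where "B = balanced_columns h"
  define C where "C = {c \<in> B. card (c - pair r) = h - 1}"
  have "card B \<le> 3 * card C"
    using card_balanced_columns_le[of h] card_free_balanced_columns_ge[OF assms(1)] assms
    by (simp add: B_def C_def)
  then have "card B * card (hard_family h n) \<le> 3 * (card C * card (hard_family h n))"
    using mult_right_mono[of "card B" "3 * card C" "card (hard_family h n)"] by simp
  also have "card C * card (hard_family h n) = card {S \<in> hard_family h n. S j \<in> C} * card B"
    unfolding hard_family_def B_def[symmetric]
    by (rule card_PiE_coordinate[symmetric]) (use assms in \<open>auto simp: C_def\<close>)
  also have "{S \<in> hard_family h n. S j \<in> C} = {S \<in> hard_family h n. j \<in> free_columns h n r S}"
    using assms by (auto simp: C_def B_def free_columns_def balanced_column_hard_family)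
  finally have "card B * card (hard_family h n)
      \<le> card B * (3 * card {S \<in> hard_family h n. j \<in> free_columns h n r S})"
    by (simp add: mult_ac)
  moreover have "card B > 0"
    using balanced_column_hard_family[OF _ assms(2)] hard_family_nonempty[of h n]
      finite_balanced_columns[of h]
    by (auto simp: B_def card_gt_0_iff)
  ultimately show ?thesis by simp
qed

lemma card_many_hits_ge:
  fixes \<delta> :: real
  assumes fin: "finite \<Omega>" "finite J" and "J \<noteq> {}" "0 \<le> \<delta>"
    and sub: "\<And>S. S \<in> \<Omega> \<Longrightarrow> F S \<subseteq> J"
    and hits: "\<And>j. j \<in> J \<Longrightarrow> 2 * \<delta> * card \<Omega> \<le> card {S \<in> \<Omega>. j \<in> F S}"
  shows "\<delta> * card \<Omega> \<le> card {S \<in> \<Omega>. \<delta> * card J \<le> card (F S)}"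
proof -
  define M where "M = {S \<in> \<Omega>. \<delta> * card J \<le> card (F S)}"
  have "card J * (2 * \<delta> * card \<Omega>) \<le> (\<Sum>j\<in>J. real (card {S \<in> \<Omega>. j \<in> F S}))"
    using sum_mono[OF hits] by simp
  also have "\<dots> = real (\<Sum>S\<in>\<Omega>. card {j \<in> J. j \<in> F S})"
    unfolding of_nat_sum[symmetric] of_nat_eq_iff
    by (rule sum_multicount_gen[symmetric]) (use fin in auto)
  also have "\<dots> \<le> (\<Sum>S\<in>\<Omega>. \<delta> * card J + (if S \<in> M then real (card J) else 0))"
  proof (unfold of_nat_sum, rule sum_mono)
    fix S assume "S \<in> \<Omega>"
    then have "{j \<in> J. j \<in> F S} = F S" "card (F S) \<le> card J" "0 \<le> \<delta> * card J"
      using sub fin \<open>0 \<le> \<delta>\<close> by (auto intro: card_mono)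
    then show "real (card {j \<in> J. j \<in> F S}) \<le> \<delta> * card J + (if S \<in> M then real (card J) else 0)"
      using \<open>S \<in> \<Omega>\<close> by (auto simp: M_def)
  qed
  also have "\<dots> = card J * (\<delta> * card \<Omega> + card M)"
    using fin by (simp add: sum.distrib sum.If_cases M_def Int_def algebra_simps)
  finally have "card J * (2 * \<delta> * card \<Omega>) \<le> card J * (\<delta> * card \<Omega> + card M)" .
  then have "2 * \<delta> * card \<Omega> \<le> \<delta> * card \<Omega> + card M"
    by (rule mult_left_le_imp_le) (use fin \<open>J \<noteq> {}\<close> in \<open>simp add: card_gt_0_iff\<close>)
  then show ?thesis by (simp add: M_def)
qed

definition many_free_family :: "nat \<Rightarrow> nat \<Rightarrow> nat \<Rightarrow> (nat \<Rightarrow> nat set) set" where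
  "many_free_family h n r = {S \<in> hard_family h n. real n / 6 \<le> card (free_columns h n r S)}"

lemma card_many_free_family_ge:
  assumes "r < h" "n \<ge> 1"
  shows "real (card (hard_family h n)) \<le> 6 * card (many_free_family h n r)"
proof -
  have "2 * (1 / 6) * card (hard_family h n) \<le> real (card {S \<in> hard_family h n. j \<in> free_columns h n r S})"
    if "j < n" for j
    using card_free_column_ge[OF assms(1) that] by simp
  then have "1 / 6 * card (hard_family h n)
      \<le> card {S \<in> hard_family h n. 1 / 6 * card {..<n} \<le> card (free_columns h n r S)}"
    using assms(2) free_columns_subset
    by (intro card_many_hits_ge) (auto simp: finite_hard_family lessThan_empty_iff)
  then show ?thesis by (simp add: many_free_family_def)
qed

subsection \<open>Recombining the inputs of a pair\<close>

definition recombine :: "nat \<Rightarrow> nat set \<Rightarrow> (nat \<Rightarrow> nat set) \<Rightarrow> nat set \<Rightarrow> nat set \<Rightarrow> nat \<Rightarrow> nat set" where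
  "recombine r J S x y j =
     {i. if j \<in> J \<and> i \<in> pair r then j \<in> (if i = 2 * r then x else y) else i \<in> S j}"

definition erase_free :: "nat \<Rightarrow> nat \<Rightarrow> nat \<Rightarrow> (nat \<Rightarrow> nat set) \<Rightarrow> nat \<Rightarrow> nat set" where
  "erase_free h n r S = recombine r (free_columns h n r S) S {} {}"

lemma free_columns_recombine: "free_columns h n r (recombine r J S x y) = free_columns h n r S"
proof -
  have "recombine r J S x y j - pair r = S j - pair r" for j
    by (auto simp: recombine_def)
  then show ?thesis by (simp add: free_columns_def)
qed

lemma free_columns_erase_free: "free_columns h n r (erase_free h n r S) = free_columns h n r S"
  by (simp add: erase_free_def free_columns_recombine)

lemma recombine_recombine: "recombine r J (recombine r J S x y) x' y' = recombine r J S x' y'"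
  by (rule ext) (auto simp: recombine_def)

lemma card_recombine:
  assumes "S \<in> hard_family h n" "j \<in> free_columns h n r S"
  shows "card (recombine r (free_columns h n r S) S x y j) = h - 1 + of_bool (j \<in> x) + of_bool (j \<in> y)"
proof -
  define E where "E = S j - pair r"
  have "S j \<in> balanced_columns h"
    using assms by (auto simp: free_columns_def intro: balanced_column_hard_family)
  then have "finite (S j)" by (auto simp: balanced_columns_def intro: finite_subset)
  then have E: "card E = h - 1" "finite E" "2 * r \<notin> E" "2 * r + 1 \<notin> E"
    using assms(2) by (auto simp: E_def free_columns_def pair_def)
  have "recombine r (free_columns h n r S) S x y j
      = E \<union> (if j \<in> x then {2 * r} else {}) \<union> (if j \<in> y then {2 * r + 1} else {})"
    using assms(2) by (auto simp: recombine_def E_def pair_def)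
  then show ?thesis using E by auto
qed

lemma recombine_in_hard_family:
  assumes "S \<in> hard_family h n" "r < h"
  shows "recombine r (free_columns h n r S) S x y \<in> hard_family h n"
proof -
  define J where "J = free_columns h n r S"
  have "recombine r J S x y j \<in> balanced_columns h" if "j < n" for j
  proof (cases "j \<in> J")
    case True
    have "recombine r J S x y j \<subseteq> {..<2 * h}"
      using balanced_column_hard_family[OF assms(1) that] assms(2)
      by (auto simp: recombine_def balanced_columns_def pair_def split: if_splits)
    then show ?thesis
      using card_recombine[OF assms(1) True[unfolded J_def], of x y] assms(2)
      by (auto simp: balanced_columns_def J_def)
  next
    case False
    then show ?thesis
      using balanced_column_hard_family[OF assms(1) that] by (simp add: recombine_def)
  qed
  moreover have "recombine r J S x y j = undefined" if "\<not> j < n" for j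
  proof -
    have "S j = undefined"
      using PiE_arb[of S "{..<n}" _ j] assms(1) that by (simp add: hard_family_def)
    then show ?thesis using that by (simp add: recombine_def J_def free_columns_def)
  qed
  ultimately show ?thesis by (auto simp: hard_family_def PiE_iff extensional_def J_def)
qed

lemma bij_betw_recombine:
  assumes "S \<in> hard_family h n" "r < h"
  defines "J \<equiv> free_columns h n r S"
  shows "bij_betw (\<lambda>(x, y). recombine r J S x y) (Pow J \<times> Pow J)
    {S' \<in> hard_family h n. erase_free h n r S' = erase_free h n r S}"
proof (rule bij_betw_byWitness[where f' = "\<lambda>S'. ({j \<in> J. 2 * r \<in> S' j}, {j \<in> J. 2 * r + 1 \<in> S' j})"])
  show "(\<lambda>(x, y). recombine r J S x y) ` (Pow J \<times> Pow J)
      \<subseteq> {S' \<in> hard_family h n. erase_free h n r S' = erase_free h n r S}"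
    using recombine_in_hard_family[OF assms(1,2)]
    by (auto simp: erase_free_def free_columns_recombine recombine_recombine J_def)
  show "\<forall>S'\<in>{S' \<in> hard_family h n. erase_free h n r S' = erase_free h n r S}.
      (case ({j \<in> J. 2 * r \<in> S' j}, {j \<in> J. 2 * r + 1 \<in> S' j}) of (x, y) \<Rightarrow> recombine r J S x y) = S'"
  proof clarsimp
    fix S' assume eq: "erase_free h n r S' = erase_free h n r S"
    then have "free_columns h n r S' = J" by (metis free_columns_erase_free J_def)
    then have "i \<in> recombine r J S' {} {} j \<longleftrightarrow> i \<in> recombine r J S {} {} j" for i j
      using eq by (simp add: erase_free_def J_def)
    then have "i \<in> S' j \<longleftrightarrow> i \<in> S j" if "\<not> (j \<in> J \<and> i \<in> pair r)" for i j
      using that by (simp add: recombine_def) metis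
    then show "recombine r J S {j \<in> J. 2 * r \<in> S' j} {j \<in> J. Suc (2 * r) \<in> S' j} = S'"
      by (intro ext set_eqI) (auto simp: recombine_def pair_def)
  qed
qed (auto simp: recombine_def pair_def)

lemma unbalanced_recombine:
  assumes "S \<in> hard_family h n" "r < h"
  defines "J \<equiv> free_columns h n r S"
  shows "unbalanced h n (recombine r J S x y) = card {j. j < n \<and> j \<notin> J \<and> card (S j) \<noteq> h} + agree J x y"
proof -
  have free: "card (recombine r J S x y j) \<noteq> h \<longleftrightarrow> (j \<in> x \<longleftrightarrow> j \<in> y)" if "j \<in> J" for j
    using card_recombine[OF assms(1), of j r x y] that assms(2) by (auto simp: J_def)
  have fixed: "recombine r J S x y j = S j" if "j \<notin> J" for j
    using that by (simp add: recombine_def)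
  have "{j. j < n \<and> card (recombine r J S x y j) \<noteq> h}
      = {j. j < n \<and> j \<notin> J \<and> card (S j) \<noteq> h} \<union> {j \<in> J. j \<in> x \<longleftrightarrow> j \<in> y}"
    using free fixed free_columns_subset[of h n r S] unfolding J_def[symmetric] by fastforce
  moreover have "finite J" by (simp add: J_def finite_free_columns)
  ultimately show ?thesis
    unfolding unbalanced_def agree_def by (subst card_Un_disjoint[symmetric]) auto
qed

section \<open>Estimating the number of unbalanced columns\<close>

lemma card_fibrewise_le:
  fixes c :: real
  assumes "finite B"
    and fibre: "\<And>s. s \<in> B \<Longrightarrow> card {s' \<in> B. \<phi> s' = \<phi> s \<and> Q s'} \<le> c * card {s' \<in> B. \<phi> s' = \<phi> s}"
  shows "card {s \<in> B. Q s} \<le> c * card B"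
proof -
  have card_eq: "card {s \<in> B. Q' s} = (\<Sum>z\<in>\<phi> ` B. card {s \<in> B. \<phi> s = z \<and> Q' s})" for Q'
  proof -
    have "card {s \<in> B. Q' s} = card {s \<in> B. True \<and> Q' s}" by simp
    also have "\<dots> = (\<Sum>s\<in>B. of_bool (Q' s))"
      using assms(1) by (simp add: of_bool_def sum.If_cases Int_def)
    also have "\<dots> = (\<Sum>z\<in>\<phi> ` B. \<Sum>s\<in>{s \<in> B. \<phi> s = z}. of_bool (Q' s))"
      using assms(1) by (rule sum.image_gen)
    also have "\<dots> = (\<Sum>z\<in>\<phi> ` B. card {s \<in> B. \<phi> s = z \<and> Q' s})"
      using assms(1) by (intro sum.cong) (auto simp: of_bool_def sum.If_cases Int_def conj_ac)
    finally show ?thesis .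
  qed
  have "real (card {s \<in> B. Q s}) \<le> (\<Sum>z\<in>\<phi> ` B. c * card {s \<in> B. \<phi> s = z})"
    unfolding card_eq[of Q] of_nat_sum using fibre by (intro sum_mono) auto
  also have "\<dots> = c * card B"
    using card_eq[of "\<lambda>_. True"] by (simp flip: sum_distrib_left of_nat_sum)
  finally show ?thesis .
qed

lemma card_Collect_bij_betw:
  assumes "bij_betw g D F"
  shows "card {s \<in> F. Q s} = card {z \<in> D. Q (g z)}"
proof -
  have "bij_betw g {z \<in> D. Q (g z)} {s \<in> F. Q s}"
    using assms by (auto simp: bij_betw_def inj_on_def)
  then show ?thesis by (metis bij_betw_same_card)
qed

text \<open>The window below is the one that Gap Hamming tolerates on the \<open>n / 6\<close> free columns of a pair.\<close>

locale unbalanced_estimation =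
  fixes h n :: nat and X :: "(nat \<Rightarrow> nat set) \<Rightarrow> nat \<Rightarrow> 'x" and acc :: "(nat \<Rightarrow> 'x) \<Rightarrow> real \<Rightarrow> bool"
  assumes n_pos: "n \<ge> 1"
    and input_row: "\<And>i S S'. (\<And>j. i \<in> S j \<longleftrightarrow> i \<in> S' j) \<Longrightarrow> X S i = X S' i"
    and acc_close: "\<And>S S' v. S \<in> hard_family h n \<Longrightarrow> S' \<in> hard_family h n \<Longrightarrow> acc (X S) v \<Longrightarrow> acc (X S') v \<Longrightarrow>
      real (unbalanced h n S) - real (unbalanced h n S') \<le> sqrt (n / 6) / 32"
begin

lemma gap_hamming_recombine:
  assumes S: "S \<in> many_free_family h n r" and r: "r < h"
  defines "J \<equiv> free_columns h n r S"
  defines "Y \<equiv> \<lambda>x y. X (recombine r J S x y)"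
  shows "gap_hamming Y (2 * r) (2 * r + 1) (\<lambda>x y. acc (Y x y)) J"
proof
  have S_hard: "S \<in> hard_family h n" and many: "real n / 6 \<le> card J"
    using S by (auto simp: many_free_family_def J_def)
  show "Y x y (2 * r) = Y x y' (2 * r)" "Y x y (2 * r + 1) = Y x' y (2 * r + 1)" for x x' y y'
    unfolding Y_def by (rule input_row; simp add: recombine_def pair_def)+
  show "Y x y i = Y x' y' i" if "i \<noteq> 2 * r" "i \<noteq> 2 * r + 1" for i x y x' y'
    unfolding Y_def by (rule input_row) (use that in \<open>simp add: recombine_def pair_def\<close>)
  show "real (agree J x y) - real (agree J x' y') \<le> sqrt (card J) / 32"
    if "acc (Y x y) v" "acc (Y x' y') v" for x y x' y' v
  proof -
    have "real (unbalanced h n (recombine r J S x y)) - real (unbalanced h n (recombine r J S x' y'))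
        \<le> sqrt (n / 6) / 32"
      using that unfolding Y_def J_def by (intro acc_close recombine_in_hard_family[OF S_hard r])
    also have "\<dots> \<le> sqrt (card J) / 32" using many by simp
    finally show ?thesis by (simp add: J_def unbalanced_recombine[OF S_hard r])
  qed
  show "J \<noteq> {}" using many n_pos by auto
qed (simp add: J_def finite_free_columns)

definition accepted_quiet :: "'x protocol \<Rightarrow> nat \<Rightarrow> nat \<Rightarrow> (nat \<Rightarrow> nat set) \<Rightarrow> bool" where
  "accepted_quiet P r t S \<longleftrightarrow> acc (X S) (run P (X S)) \<and> bits_by (pair r) P (X S) \<le> t"

lemma card_accepted_quiet_fibre_le:
  assumes S: "S \<in> many_free_family h n r" and r: "r < h" and t: "1200 * t \<le> n"
  defines "F \<equiv> {S' \<in> hard_family h n. erase_free h n r S' = erase_free h n r S}"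
  shows "card {S' \<in> F. accepted_quiet P r t S'} \<le> 511 / 512 * card F"
proof -
  define J where "J = free_columns h n r S"
  define Y where "Y x y = X (recombine r J S x y)" for x y
  interpret gap_hamming Y "2 * r" "2 * r + 1" "\<lambda>x y. acc (Y x y)" J
    using gap_hamming_recombine[OF S r] by (simp add: J_def Y_def[abs_def])
  have bij: "bij_betw (\<lambda>(x, y). recombine r J S x y) (Pow J \<times> Pow J) F"
    unfolding F_def J_def using S r by (intro bij_betw_recombine) (auto simp: many_free_family_def)
  have "card {S' \<in> F. accepted_quiet P r t S'}
      = card {z \<in> Pow J \<times> Pow J. accepted_quiet P r t (case z of (x, y) \<Rightarrow> recombine r J S x y)}"
    by (rule card_Collect_bij_betw[OF bij])
  also have "{z \<in> Pow J \<times> Pow J. accepted_quiet P r t (case z of (x, y) \<Rightarrow> recombine r J S x y)}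
      = accepted_short P t (Pow J) (Pow J)"
    unfolding accepted_short_def by (auto simp: accepted_quiet_def Y_def pair_def)
  also have "real (card \<dots>) \<le> 511 / 512 * 4 ^ card J"
    using S t by (intro card_accepted_short_cube_le) (simp add: many_free_family_def J_def)
  also have "(4 :: real) ^ card J = card F"
    using bij_betw_same_card[OF bij] finite_nonempty(1)
    by (simp add: card_cartesian_product card_Pow flip: power_mult_distrib)
  finally show ?thesis by simp
qed

lemma card_accepted_quiet_le:
  assumes r: "r < h" and t: "1200 * t \<le> n"
  shows "card {S \<in> many_free_family h n r. accepted_quiet P r t S}
    \<le> 511 / 512 * card (many_free_family h n r)"
proof (rule card_fibrewise_le[where \<phi> = "erase_free h n r"])
  show "finite (many_free_family h n r)"
    by (simp add: many_free_family_def finite_hard_family)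
  fix S assume S: "S \<in> many_free_family h n r"
  have "S' \<in> many_free_family h n r \<longleftrightarrow> S' \<in> hard_family h n"
    if "erase_free h n r S' = erase_free h n r S" for S'
  proof -
    have "free_columns h n r S' = free_columns h n r S"
      using that by (metis free_columns_erase_free)
    then show ?thesis using S by (simp add: many_free_family_def)
  qed
  then have "{S' \<in> many_free_family h n r. erase_free h n r S' = erase_free h n r S \<and> R S'}
      = {S' \<in> {S' \<in> hard_family h n. erase_free h n r S' = erase_free h n r S}. R S'}" for R
    by auto
  from this this[of "\<lambda>_. True"]
  show "card {S' \<in> many_free_family h n r.
        erase_free h n r S' = erase_free h n r S \<and> accepted_quiet P r t S'}
      \<le> 511 / 512 * card {S' \<in> many_free_family h n r. erase_free h n r S' = erase_free h n r S}"
    using card_accepted_quiet_fibre_le[OF S r t] by simp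
qed

lemma sum_bits_by_pair_ge:
  assumes r: "r < h"
    and err: "6144 * card {S \<in> hard_family h n. \<not> acc (X S) (run P (X S))} \<le> card (hard_family h n)"
  shows "(n div 1200 + 1) * card (hard_family h n) \<le> 6144 * (\<Sum>S\<in>hard_family h n. bits_by (pair r) P (X S))"
proof -
  define t where "t = n div 1200"
  define \<Omega> where "\<Omega> = hard_family h n"
  define bad where "bad = {S \<in> \<Omega>. \<not> acc (X S) (run P (X S))}"
  define long where "long = {S \<in> \<Omega>. t < bits_by (pair r) P (X S)}"
  define M where "M = many_free_family h n r"
  define quiet where "quiet = {S \<in> M. accepted_quiet P r t S}"
  have fin: "finite \<Omega>" by (simp add: \<Omega>_def finite_hard_family)
  have "M \<subseteq> quiet \<union> (bad \<union> long)"
    by (auto simp: M_def quiet_def accepted_quiet_def bad_def long_def \<Omega>_def many_free_family_def)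
  moreover have "finite M" "finite quiet" "finite bad" "finite long"
    using fin by (auto simp: M_def quiet_def bad_def long_def \<Omega>_def many_free_family_def)
  ultimately have "card M \<le> card quiet + (card bad + card long)"
    by (meson card_mono card_Un_le add_left_mono finite_UnI order.trans)
  moreover have "card quiet \<le> 511 / 512 * card M"
    unfolding quiet_def M_def by (rule card_accepted_quiet_le[OF r]) (simp add: t_def)
  moreover have "real (card \<Omega>) \<le> 6 * card M"
    unfolding \<Omega>_def M_def by (rule card_many_free_family_ge[OF r n_pos])
  moreover have "6144 * card bad \<le> card \<Omega>" using err by (simp add: bad_def \<Omega>_def)
  ultimately have "card \<Omega> \<le> 6144 * card long" by linarith
  then have "(t + 1) * card \<Omega> \<le> 6144 * (\<Sum>S\<in>long. t + 1)"
    using mult_le_mono2[of "card \<Omega>" "6144 * card long" "t + 1"] by (simp add: algebra_simps)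
  also have "(\<Sum>S\<in>long. t + 1) \<le> (\<Sum>S\<in>long. bits_by (pair r) P (X S))"
    by (intro sum_mono) (auto simp: long_def)
  also have "\<dots> \<le> (\<Sum>S\<in>\<Omega>. bits_by (pair r) P (X S))"
    using fin by (intro sum_mono2) (auto simp: long_def)
  finally show ?thesis by (simp add: t_def \<Omega>_def)
qed

lemma deterministic_cost_ge:
  assumes "6144 * card {S \<in> hard_family h n. \<not> acc (X S) (run P (X S))} \<le> card (hard_family h n)"
    and cost: "\<And>S. S \<in> hard_family h n \<Longrightarrow> bits P (X S) \<le> C"
  shows "h * n \<le> 7372800 * C"
proof -
  define \<Omega> where "\<Omega> = hard_family h n"
  have "h * (n div 1200 + 1) * card \<Omega> = (\<Sum>r<h. (n div 1200 + 1) * card \<Omega>)"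
    by (simp add: algebra_simps)
  also have "\<dots> \<le> (\<Sum>r<h. 6144 * (\<Sum>S\<in>\<Omega>. bits_by (pair r) P (X S)))"
    unfolding \<Omega>_def by (intro sum_mono sum_bits_by_pair_ge assms(1)) simp
  also have "\<dots> = 6144 * (\<Sum>S\<in>\<Omega>. \<Sum>r<h. bits_by (pair r) P (X S))"
    unfolding sum_distrib_left[symmetric] by (subst sum.swap) simp
  also have "\<dots> \<le> 6144 * (\<Sum>S\<in>\<Omega>. C)"
    using cost by (intro mult_left_mono sum_mono order.trans[OF sum_bits_by_pairs_le]) (auto simp: \<Omega>_def)
  also have "\<dots> = 6144 * C * card \<Omega>" by simp
  finally have "h * (n div 1200 + 1) \<le> 6144 * C"
    using hard_family_nonempty[of h n] finite_hard_family[of h n] by (simp add: \<Omega>_def card_gt_0_iff)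
  have "h * n \<le> h * (1200 * (n div 1200 + 1))" by (rule mult_le_mono2) simp
  also have "\<dots> = 1200 * (h * (n div 1200 + 1))" by (simp only: mult_ac)
  also have "\<dots> \<le> 1200 * (6144 * C)" by (rule mult_le_mono2) fact
  finally show ?thesis by simp
qed

end

section \<open>The lower bound for \<open>p\<close>-norms\<close>

lemma solves_imp_good_protocol:
  assumes D: "solves k I R q D" and fin: "finite \<Omega>" and X: "X ` \<Omega> \<subseteq> I"
  shows "\<exists>P\<in>set_pmf D. real (card {S \<in> \<Omega>. \<not> R (X S) (run P (X S))}) \<le> (1 - q) * card \<Omega>"
proof (rule ccontr)
  define bad where "bad S = {P. \<not> R (X S) (run P (X S))}" for S
  define err where "err P = (\<Sum>S\<in>\<Omega>. indicator (bad S) P :: real)" for P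
  have err: "err P = card {S \<in> \<Omega>. \<not> R (X S) (run P (X S))}" for P
    using fin by (simp add: err_def bad_def indicator_def sum.If_cases Int_def)
  have int: "integrable D (indicator (bad S) :: _ \<Rightarrow> real)" for S
    by (intro measure_pmf.integrable_const_bound[where B = 1]) auto
  have "integrable D err"
    unfolding err_def by (intro Bochner_Integration.integrable_sum int)
  assume "\<not> ?thesis"
  then have "(1 - q) * card \<Omega> < measure_pmf.expectation D err"
    by (intro measure_pmf.expectation_greater \<open>integrable D err\<close>)
      (auto simp: err AE_measure_pmf_iff not_le)
  also have "\<dots> = (\<Sum>S\<in>\<Omega>. measure_pmf.prob D (bad S))"
    unfolding err_def using int by (subst Bochner_Integration.integral_sum) auto
  also have "\<dots> \<le> (\<Sum>S\<in>\<Omega>. 1 - q)"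
  proof (rule sum_mono)
    fix S assume "S \<in> \<Omega>"
    then have "q \<le> measure_pmf.prob D (- bad S)"
      using D X by (auto simp: solves_def bad_def Compl_eq)
    then show "measure_pmf.prob D (bad S) \<le> 1 - q"
      using measure_pmf.prob_compl[of "bad S" D] by (simp add: Compl_eq_Diff_UNIV)
  qed
  finally show False by (simp add: mult.commute)
qed

lemma bits_le_protocol_cost:
  assumes "P \<in> set_pmf D" "X \<in> I"
  shows "enat (bits P X) \<le> protocol_cost I D"
  unfolding protocol_cost_def by (rule SUP_upper2[OF assms(1)]) (rule SUP_upper[OF assms(2)])

text \<open>The easy direction of Yao's principle, for the uniform distribution on \<open>\<Omega>\<close>.\<close>

lemma randomized_complexity_ge_deterministic:
  fixes b q :: real
  assumes fin: "finite \<Omega>" and X: "X ` \<Omega> \<subseteq> I"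
    and det: "\<And>P C. real (card {S \<in> \<Omega>. \<not> R (X S) (run P (X S))}) \<le> (1 - q) * card \<Omega> \<Longrightarrow>
      (\<And>S. S \<in> \<Omega> \<Longrightarrow> bits P (X S) \<le> C) \<Longrightarrow> b \<le> real C"
  shows "ereal b \<le> ereal_of_enat (randomized_complexity k I R q)"
proof -
  have "enat (nat \<lceil>b\<rceil>) \<le> randomized_complexity k I R q"
    unfolding randomized_complexity_def
  proof (rule INF_greatest)
    fix D assume "D \<in> {D. solves k I R q D}"
    then obtain P where P: "P \<in> set_pmf D"
        "real (card {S \<in> \<Omega>. \<not> R (X S) (run P (X S))}) \<le> (1 - q) * card \<Omega>"
      using solves_imp_good_protocol[OF _ fin X] by blast
    show "enat (nat \<lceil>b\<rceil>) \<le> protocol_cost I D"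
    proof (cases "protocol_cost I D")
      case (enat C)
      have "bits P (X S) \<le> C" if "S \<in> \<Omega>" for S
        using bits_le_protocol_cost[OF P(1), of "X S" I] X that by (auto simp: enat)
      then have "b \<le> real C" by (rule det[OF P(2)])
      then show ?thesis by (simp add: enat ceiling_le_iff nat_le_iff)
    qed simp
  qed
  then have "ereal_of_enat (enat (nat \<lceil>b\<rceil>)) \<le> ereal_of_enat (randomized_complexity k I R q)"
    by (simp only: ereal_of_enat_le_iff)
  moreover have "ereal b \<le> ereal_of_enat (enat (nat \<lceil>b\<rceil>))"
    using real_nat_ceiling_ge by simp
  ultimately show ?thesis by (rule order.trans[rotated])
qed

lemma lp_norm_two_valued:
  fixes p :: real and s :: "nat \<Rightarrow> int"
  assumes p: "p > 0" and c: "c \<ge> 0" and s: "\<And>j. j < N \<Longrightarrow> s j = 0 \<or> \<bar>s j\<bar> = c"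
  shows "lp_norm p N s = c * real (card {j. j < N \<and> s j \<noteq> 0}) powr (1 / p)"
proof -
  have "(\<Sum>j<N. \<bar>real_of_int (s j)\<bar> powr p) = (\<Sum>j<N. if s j \<noteq> 0 then real_of_int c powr p else 0)"
  proof (rule sum.cong)
    fix j assume "j \<in> {..<N}"
    then have "s j = 0 \<or> \<bar>real_of_int (s j)\<bar> = c"
      using s[of j] by (metis lessThan_iff of_int_abs)
    then show "\<bar>real_of_int (s j)\<bar> powr p = (if s j \<noteq> 0 then real_of_int c powr p else 0)" by auto
  qed simp
  also have "\<dots> = real (card {j. j < N \<and> s j \<noteq> 0}) * real_of_int c powr p"
    by (simp add: sum.If_cases Int_def)
  finally show ?thesis using p c by (simp add: lp_norm_def powr_mult powr_powr)
qed

definition hard_input :: "nat \<Rightarrow> nat \<Rightarrow> nat \<Rightarrow> nat \<Rightarrow> (nat \<Rightarrow> nat set) \<Rightarrow> nat \<Rightarrow> nat \<Rightarrow> int" where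
  "hard_input k N h n S =
     (\<lambda>i\<in>{..<k}. \<lambda>j\<in>{..<N}. if i < 2 * h \<and> j < n then (if i \<in> S j then 1 else - 1) else 0)"

lemma hard_input_in_party_inputs:
  assumes "d > 0" "N \<ge> 1"
  shows "hard_input k N h n S \<in> party_inputs d k N"
proof -
  have "1 \<le> real N powr d" using assms by (intro ge_one_powr_ge_zero) auto
  then show ?thesis by (auto simp: hard_input_def party_inputs_def)
qed

lemma sum_hard_input:
  assumes S: "S \<in> hard_family h n" and "2 * h \<le> k" "j < N"
  shows "(\<Sum>i<k. hard_input k N h n S i j) = (if j < n then 2 * (int (card (S j)) - int h) else 0)"
proof (cases "j < n")
  case True
  have "(\<Sum>i<k. hard_input k N h n S i j) = (\<Sum>i<k. if i < 2 * h then 2 * of_bool (i \<in> S j) - 1 else 0)"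
    using assms True by (intro sum.cong) (auto simp: hard_input_def)
  also have "\<dots> = (\<Sum>i<2 * h. 2 * of_bool (i \<in> S j) - 1)"
    using assms by (intro sum.mono_neutral_cong_right) auto
  also have "\<dots> = 2 * int (card ({..<2 * h} \<inter> S j)) - 2 * int h"
    by (simp add: sum_subtractf of_bool_def sum.If_cases Int_def flip: sum_distrib_left)
  also have "{..<2 * h} \<inter> S j = S j"
    using balanced_column_hard_family[OF S True] by (auto simp: balanced_columns_def)
  finally show ?thesis using True by simp
qed (use assms(3) in \<open>simp add: hard_input_def\<close>)

lemma lp_norm_hard_input:
  fixes p :: real
  assumes "p > 0" and S: "S \<in> hard_family h n" and "2 * h \<le> k" "n \<le> N"
  shows "lp_norm p N (\<lambda>j. \<Sum>i<k. hard_input k N h n S i j) = 2 * real (unbalanced h n S) powr (1 / p)"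
proof -
  define s where "s j = (\<Sum>i<k. hard_input k N h n S i j)" for j
  have s: "s j = (if j < n then 2 * (int (card (S j)) - int h) else 0)" if "j < N" for j
    unfolding s_def using that by (rule sum_hard_input[OF S assms(3)])
  have "s j = 0 \<or> \<bar>s j\<bar> = 2" if "j < N" for j
  proof (cases "j < n")
    case True
    then have "h \<le> card (S j) + 1" "card (S j) \<le> h + 1"
      using balanced_column_hard_family[OF S True] by (auto simp: balanced_columns_def)
    then show ?thesis using s[OF that] True by (cases "card (S j)" h rule: linorder_cases) auto
  qed (use s[OF that] in simp)
  then have "lp_norm p N s = 2 * real (card {j. j < N \<and> s j \<noteq> 0}) powr (1 / p)"
    using lp_norm_two_valued[of p 2 N s] assms(1) by simp
  moreover have "{j. j < N \<and> s j \<noteq> 0} = {j. j < n \<and> card (S j) \<noteq> h}"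
    using s assms(4) by (auto split: if_splits)
  ultimately show ?thesis by (simp add: unbalanced_def flip: s_def)
qed

lemma le_exp_mult_of_root_ratio:
  fixes p \<epsilon> a b :: real
  assumes "p > 0" "0 < \<epsilon>" "0 \<le> a" "0 \<le> b" and "a powr (1 / p) \<le> (1 + \<epsilon>)\<^sup>2 * b powr (1 / p)"
  shows "a \<le> exp (2 * p * \<epsilon>) * b"
proof -
  note assms(5)
  also have "(1 + \<epsilon>)\<^sup>2 * b powr (1 / p) \<le> (exp \<epsilon>)\<^sup>2 * b powr (1 / p)"
    using assms(2) by (intro mult_right_mono power_mono exp_ge_add_one_self) auto
  finally have "(a powr (1 / p)) powr p \<le> ((exp \<epsilon>)\<^sup>2 * b powr (1 / p)) powr p"
    using assms by (intro powr_mono2) auto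
  then have "a \<le> ((exp \<epsilon>)\<^sup>2) powr p * b"
    using assms by (simp add: powr_powr powr_mult)
  also have "((exp \<epsilon>)\<^sup>2) powr p = exp (2 * p * \<epsilon>)"
    by (simp add: powr_def ln_realpow mult_ac)
  finally show ?thesis .
qed

lemma approximates_hard_input_ratio:
  fixes p \<epsilon> :: real
  assumes "p > 0" "0 < \<epsilon>" "2 * h \<le> k" "n \<le> N"
    and S: "S \<in> hard_family h n" "approximates_lp_norm p k N \<epsilon> (hard_input k N h n S) v"
    and S': "S' \<in> hard_family h n" "approximates_lp_norm p k N \<epsilon> (hard_input k N h n S') v"
  shows "real (unbalanced h n S) \<le> exp (2 * p * \<epsilon>) * unbalanced h n S'"
proof (rule le_exp_mult_of_root_ratio)
  have "2 * real (unbalanced h n S) powr (1 / p) / (1 + \<epsilon>) \<le> v"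
    "v \<le> (1 + \<epsilon>) * (2 * real (unbalanced h n S') powr (1 / p))"
    using S S' assms(1-4) by (simp_all add: approximates_lp_norm_def lp_norm_hard_input Let_def)
  then have "2 * real (unbalanced h n S) powr (1 / p) / (1 + \<epsilon>)
      \<le> (1 + \<epsilon>) * (2 * real (unbalanced h n S') powr (1 / p))"
    by (rule order.trans)
  then show "real (unbalanced h n S) powr (1 / p) \<le> (1 + \<epsilon>)\<^sup>2 * real (unbalanced h n S') powr (1 / p)"
    using assms(2) by (simp add: divide_le_eq power2_eq_square mult_ac)
qed (use assms in auto)

lemma diff_le_of_exp_ratio:
  fixes p \<epsilon> :: real and a b n :: nat
  assumes "p > 0" "0 < \<epsilon>" "a \<le> n" and ratio: "real a \<le> exp (2 * p * \<epsilon>) * b"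
    and n: "n = 1 \<or> 24576 * p\<^sup>2 * \<epsilon>\<^sup>2 * n \<le> 1"
  shows "real a - real b \<le> sqrt (n / 6) / 32"
  using n
proof
  assume "n = 1"
  have "b = 0 \<Longrightarrow> a = 0" using ratio by simp
  then have "real a - real b \<le> 0" using \<open>n = 1\<close> \<open>a \<le> n\<close> by (cases b) auto
  then show ?thesis by (rule order.trans) simp
next
  assume small: "24576 * p\<^sup>2 * \<epsilon>\<^sup>2 * n \<le> 1"
  have "exp (- (2 * p * \<epsilon>)) * real a \<le> exp (- (2 * p * \<epsilon>)) * (exp (2 * p * \<epsilon>) * b)"
    using ratio by (intro mult_left_mono) auto
  also have "\<dots> = b" by (simp add: exp_minus)
  finally have "exp (- (2 * p * \<epsilon>)) * real a \<le> b" .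
  moreover have "(1 - 2 * p * \<epsilon>) * real a \<le> exp (- (2 * p * \<epsilon>)) * real a"
    using exp_ge_add_one_self[of "- (2 * p * \<epsilon>)"] by (intro mult_right_mono) auto
  ultimately have "real a - real b \<le> 2 * p * \<epsilon> * a" by (simp add: algebra_simps)
  also have "\<dots> \<le> 2 * p * \<epsilon> * n" using assms(1-3) by (intro mult_left_mono) auto
  also have "\<dots> \<le> sqrt (n / 6) / 32"
  proof -
    have "n * (24576 * p\<^sup>2 * \<epsilon>\<^sup>2 * n) \<le> real n * 1" by (intro mult_left_mono small) simp
    then have "(64 * p * \<epsilon> * n)\<^sup>2 \<le> n / 6" by (simp add: power_mult_distrib power2_eq_square mult_ac)
    then have "64 * p * \<epsilon> * n \<le> sqrt (n / 6)" by (rule real_le_rsqrt)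
    then show ?thesis by simp
  qed
  finally show ?thesis .
qed

lemma unbalanced_estimation_hard_input:
  fixes p \<epsilon> :: real
  assumes "p > 0" "0 < \<epsilon>" "2 * h \<le> k" "1 \<le> n" "n \<le> N" and n: "n = 1 \<or> 24576 * p\<^sup>2 * \<epsilon>\<^sup>2 * n \<le> 1"
  shows "unbalanced_estimation h n (hard_input k N h n) (approximates_lp_norm p k N \<epsilon>)"
proof
  show "hard_input k N h n S i = hard_input k N h n S' i" if "\<And>j. i \<in> S j \<longleftrightarrow> i \<in> S' j" for i S S'
    using that by (auto simp: hard_input_def restrict_def fun_eq_iff)
  show "real (unbalanced h n S) - real (unbalanced h n S') \<le> sqrt (n / 6) / 32"
    if "S \<in> hard_family h n" "S' \<in> hard_family h n"
      "approximates_lp_norm p k N \<epsilon> (hard_input k N h n S) v"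
      "approximates_lp_norm p k N \<epsilon> (hard_input k N h n S') v"
    for S S' v
    using that assms
    by (intro diff_le_of_exp_ratio[OF assms(1,2) unbalanced_le _ n] approximates_hard_input_ratio)
qed (rule assms)

lemma lp_norm_complexity_ge:
  fixes p \<epsilon> :: real
  assumes "p > 0" "d > 0" "0 < \<epsilon>" "2 * h \<le> k" "1 \<le> n" "n \<le> N"
    and "n = 1 \<or> 24576 * p\<^sup>2 * \<epsilon>\<^sup>2 * n \<le> 1"
  shows "ereal (real h * real n / 7372800) \<le> ereal_of_enat (lp_norm_complexity p d k N \<epsilon> (1 - 1 / 6144))"
  unfolding lp_norm_complexity_def
proof (rule randomized_complexity_ge_deterministic)
  interpret unbalanced_estimation h n "hard_input k N h n" "approximates_lp_norm p k N \<epsilon>"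
    using assms by (intro unbalanced_estimation_hard_input)
  show "hard_input k N h n ` hard_family h n \<subseteq> party_inputs d k N"
    using assms by (auto intro!: hard_input_in_party_inputs)
  fix P C
  assume err: "real (card {S \<in> hard_family h n.
        \<not> approximates_lp_norm p k N \<epsilon> (hard_input k N h n S) (run P (hard_input k N h n S))})
      \<le> (1 - (1 - 1 / 6144)) * card (hard_family h n)"
    and cost: "\<And>S. S \<in> hard_family h n \<Longrightarrow> bits P (hard_input k N h n S) \<le> C"
  have "h * n \<le> 7372800 * C"
    by (rule deterministic_cost_ge[OF _ cost]) (use err in simp)
  then have "real (h * n) \<le> real (7372800 * C)" by (simp only: of_nat_le_iff)
  then show "real h * real n / 7372800 \<le> real C" by simp
qed (rule finite_hard_family)

lemma exists_hard_dimension: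
  fixes p \<epsilon> :: real
  assumes "p \<ge> 1" "0 < \<epsilon>" "\<epsilon> < 1" "1 / \<epsilon>\<^sup>2 \<le> real N"
  obtains n :: nat where "1 \<le> n" "n \<le> N" "n = 1 \<or> 24576 * p\<^sup>2 * \<epsilon>\<^sup>2 * n \<le> 1"
    and "1 / \<epsilon>\<^sup>2 \<le> 49152 * p\<^sup>2 * n"
proof
  define x where "x = 1 / \<epsilon>\<^sup>2 / (24576 * p\<^sup>2)"
  define n where "n = max 1 (nat \<lfloor>x\<rfloor>)"
  have p: "1 \<le> p\<^sup>2" and e: "0 < \<epsilon>\<^sup>2" "\<epsilon>\<^sup>2 \<le> 1"
    using assms by (auto simp: power_le_one)
  have "x \<ge> 0" by (simp add: x_def)
  then have floor: "real (nat \<lfloor>x\<rfloor>) \<le> x" "x < real (nat \<lfloor>x\<rfloor>) + 1" by linarith+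
  show "1 \<le> n" by (simp add: n_def)
  have "1 \<le> 1 / \<epsilon>\<^sup>2" using e by simp
  moreover have "x \<le> 1 / \<epsilon>\<^sup>2 / 1"
    unfolding x_def using p by (intro divide_left_mono) auto
  ultimately have "real n \<le> N" using floor assms(4) unfolding n_def by linarith
  then show "n \<le> N" by simp
  have x: "24576 * p\<^sup>2 * x = 1 / \<epsilon>\<^sup>2" using assms(1) by (simp add: x_def)
  show "n = 1 \<or> 24576 * p\<^sup>2 * \<epsilon>\<^sup>2 * n \<le> 1"
  proof (cases "n = 1")
    case False
    then have "real n \<le> x" using floor unfolding n_def by linarith
    then have "24576 * p\<^sup>2 * \<epsilon>\<^sup>2 * n \<le> 24576 * p\<^sup>2 * \<epsilon>\<^sup>2 * x" by (intro mult_left_mono) auto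
    also have "\<dots> = \<epsilon>\<^sup>2 * (24576 * p\<^sup>2 * x)" by simp
    also have "\<dots> = 1" unfolding x using e by simp
    finally show ?thesis by simp
  qed simp
  have "x \<le> 2 * real n" using floor unfolding n_def by linarith
  then have "24576 * p\<^sup>2 * x \<le> 24576 * p\<^sup>2 * (2 * real n)" by (intro mult_left_mono) auto
  then show "1 / \<epsilon>\<^sup>2 \<le> 49152 * p\<^sup>2 * n" by (simp add: x)
qed

theorem theorem13:
  fixes p d :: real
  assumes "p \<ge> 1" and "d > 0"
  shows "\<exists>q c C :: real. 0 < q \<and> q < 1 \<and> 0 < c \<and> 0 < C \<and>
           (\<forall>(k :: nat) (N :: nat) (\<epsilon> :: real).
              2 \<le> k \<longrightarrow> 0 < \<epsilon> \<longrightarrow> \<epsilon> < 1 \<longrightarrow> C / \<epsilon>\<^sup>2 \<le> real N \<longrightarrow>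
              ereal (c * real k / \<epsilon>\<^sup>2) \<le> ereal_of_enat (lp_norm_complexity p d k N \<epsilon> q))"
proof -
  define c where "c = 1 / (3 * 7372800 * 49152 * p\<^sup>2)"
  have bound: "ereal (c * real k / \<epsilon>\<^sup>2) \<le> ereal_of_enat (lp_norm_complexity p d k N \<epsilon> (1 - 1 / 6144))"
    if k: "2 \<le> k" and \<epsilon>: "0 < \<epsilon>" "\<epsilon> < 1" and N: "1 / \<epsilon>\<^sup>2 \<le> real N" for k N \<epsilon>
  proof -
    obtain n where n: "1 \<le> n" "n \<le> N" "n = 1 \<or> 24576 * p\<^sup>2 * \<epsilon>\<^sup>2 * n \<le> 1" "1 / \<epsilon>\<^sup>2 \<le> 49152 * p\<^sup>2 * n"
      using exists_hard_dimension[OF assms(1) \<epsilon> N] .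
    have "k \<le> 3 * (k div 2)" using k by presburger
    then have "c * (real k * (1 / \<epsilon>\<^sup>2)) \<le> c * ((3 * real (k div 2)) * (49152 * p\<^sup>2 * n))"
      using n(4) by (intro mult_left_mono mult_mono) (auto simp: c_def)
    also have "\<dots> = real (k div 2) * real n / 7372800"
      using assms(1) by (simp add: c_def)
    also have "ereal \<dots> \<le> ereal_of_enat (lp_norm_complexity p d k N \<epsilon> (1 - 1 / 6144))"
      using assms \<epsilon> n by (intro lp_norm_complexity_ge) auto
    finally show ?thesis by simp
  qed
  show ?thesis
    by (intro exI[of _ "1 - 1 / 6144"] exI[of _ c] exI[of _ 1])
      (use bound assms(1) in \<open>auto simp: c_def\<close>)
qed

end
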